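(* Let $m\ge1$, $1<p_i<\infty$ for $i=1,\dots,m$, and $\frac1p=\frac1{p_1}+\dots+\frac1{p_m}$. Let $v$ and $w_1,\dots,w_m$ be weights on $\mathbb{R}^n$, let $\overrightarrow w=(w_1,\dots,w_m)$, $\sigma_i=w_i^{1-p_i'}$ and $\overrightarrow\sigma=(\sigma_1,\dots,\sigma_m)$. Then $$\|\mathcal{M}(\overrightarrow{f\sigma})\|_{L^p(v)}\lesssim\big([v,\overrightarrow w]_{A_{\overrightarrow P}}\,[\overrightarrow\sigma]_{W^\infty_{\overrightarrow P}}\big)^{1/p}\prod_{i=1}^m\|f_i\|_{L^{p_i}(\sigma_i)}\qquad\text{for all } f_i\in L^{p_i}(\sigma_i),\ i=1,\dots,m,$$ where $\overrightarrow{f\sigma}=(f_1\sigma_1,\dots,f_m\sigma_m)$.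
   Context: A weight is a locally integrable function on $\mathbb{R}^n$ that is positive almost everywhere; the functions $\sigma_i=w_i^{1-p_i'}$ are also understood to be weights. Here $p_i'=p_i/(p_i-1)$, $\overrightarrow P=(p_1,\dots,p_m)$, and $\|f\|_{L^q(\sigma)}=\big(\int_{\mathbb{R}^n}|f|^q\sigma\,dx\big)^{1/q}$. All suprema below are over cubes $Q\subset\mathbb{R}^n$. The multisublinear maximal function of $\overrightarrow g=(g_1,\dots,g_m)$ is $$\mathcal{M}(\overrightarrow g)(x)=\sup_{Q\ni x}\prod_{i=1}^m\frac{1}{|Q|}\int_Q|g_i(y_i)|\,dy_i,$$ the supremum being over all cubes $Q$ containing $x$. $M$ denotes the Hardy--Littlewood maximal operator, $Mg(x)=\sup_{Q\ni x}\frac1{|Q|}\int_Q|g|\,dy$. The two-weight multilinear $A_{\overrightarrow P}$ constant is $$[v,\overrightarrow w]_{A_{\overrightarrow P}}=\sup_Q\Big(\frac1{|Q|}\int_Qv\,dx\Big)\prod_{i=1}^m\Big(\frac1{|Q|}\int_Qw_i^{1-p_i'}\,dx\Big)^{p/p_i'},$$ and the $W^\infty_{\overrightarrow P}$ constant is $$[\overrightarrow\sigma]_{W^\infty_{\overrightarrow P}}=\sup_Q\Big(\int_Q\prod_{i=1}^mM(\sigma_i\chi_Q)^{\frac p{p_i}}\,dx\Big)\Big(\int_Q\prod_{i=1}^m\sigma_i^{\frac p{p_i}}\,dx\Big)^{-1}.$$ $A\lesssim B$ means $A\le cB$ with a constant $c$ independent of the weights, of the weight constants and of the functions $f_i$ ($c$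 may depend on $n$, $m$ and $\overrightarrow P$). *)

theory Defs
  imports "HOL-Analysis.Analysis"
begin

(* Power of an extended nonnegative number by a positive real exponent, with
   top powr a = top.  It is only used below with a > 0, where 0 powr a = 0. *)
definition epowr :: "ennreal \<Rightarrow> real \<Rightarrow> ennreal" where
  "epowr x a = (if x = top then top else ennreal (enn2real x powr a))"

definition conj_exp :: "real \<Rightarrow> real" where
  "conj_exp q = q / (q - 1)"

(* Cubes have sides parallel to the axes and positive side length; they are taken closed. *)
definition cubes :: "(real ^ 'n) set set" where
  "cubes = {cbox a (\<chi> i. a $ i + r) | a r. 0 < r}"

(* Absolute integrability is with respect to Lebesgue measure, so this also makes w
   Lebesgue measurable. *)
definition locally_integrable :: "(real ^ 'n \<Rightarrow> real) \<Rightarrow> bool" where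
  "locally_integrable w \<longleftrightarrow> (\<forall>K. compact K \<longrightarrow> w absolutely_integrable_on K)"

definition weight :: "(real ^ 'n \<Rightarrow> real) \<Rightarrow> bool" where
  "weight w \<longleftrightarrow> locally_integrable w \<and> (AE x in lebesgue. 0 < w x)"

definition avg :: "(real ^ 'n) set \<Rightarrow> (real ^ 'n \<Rightarrow> real) \<Rightarrow> ennreal" where
  "avg Q g = (\<integral>\<^sup>+y\<in>Q. ennreal \<bar>g y\<bar> \<partial>lebesgue) / emeasure lebesgue Q"

definition HL_maximal :: "(real ^ 'n \<Rightarrow> real) \<Rightarrow> real ^ 'n \<Rightarrow> ennreal" where
  "HL_maximal g x = (SUP Q\<in>{Q\<in>cubes. x \<in> Q}. avg Q g)"

definition multi_maximal :: "nat \<Rightarrow> (nat \<Rightarrow> real ^ 'n \<Rightarrow> real) \<Rightarrow> real ^ 'n \<Rightarrow> ennreal" where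
  "multi_maximal m g x = (SUP Q\<in>{Q\<in>cubes. x \<in> Q}. \<Prod>i=1..m. avg Q (g i))"

(* The functions measured are extended-valued because maximal functions are;
   a real function f enters as the function ennreal |f x|. *)
definition Lp_norm :: "real \<Rightarrow> (real ^ 'n \<Rightarrow> real) \<Rightarrow> (real ^ 'n \<Rightarrow> ennreal) \<Rightarrow> ennreal" where
  "Lp_norm q \<sigma> g = epowr (\<integral>\<^sup>+x. epowr (g x) q * ennreal (\<sigma> x) \<partial>lebesgue) (1 / q)"

definition in_Lp :: "real \<Rightarrow> (real ^ 'n \<Rightarrow> real) \<Rightarrow> (real ^ 'n \<Rightarrow> real) \<Rightarrow> bool" where
  "in_Lp q \<sigma> f \<longleftrightarrow>
     f \<in> borel_measurable lebesgue \<and> Lp_norm q \<sigma> (\<lambda>x. ennreal \<bar>f x\<bar>) < top"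

definition dual_weight :: "real \<Rightarrow> (real ^ 'n \<Rightarrow> real) \<Rightarrow> real ^ 'n \<Rightarrow> real" where
  "dual_weight q w x = w x powr (1 - conj_exp q)"

definition A_const ::
  "nat \<Rightarrow> (nat \<Rightarrow> real) \<Rightarrow> real \<Rightarrow> (real ^ 'n \<Rightarrow> real) \<Rightarrow> (nat \<Rightarrow> real ^ 'n \<Rightarrow> real) \<Rightarrow> ennreal" where
  "A_const m P p v w =
     (SUP Q\<in>cubes. avg Q v *
        (\<Prod>i=1..m. epowr (avg Q (dual_weight (P i) (w i))) (p / conj_exp (P i))))"

definition W_const ::
  "nat \<Rightarrow> (nat \<Rightarrow> real) \<Rightarrow> real \<Rightarrow> (nat \<Rightarrow> real ^ 'n \<Rightarrow> real) \<Rightarrow> ennreal" where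
  "W_const m P p \<sigma> =
     (SUP Q\<in>cubes.
        (\<integral>\<^sup>+x\<in>Q. (\<Prod>i=1..m. epowr (HL_maximal (\<lambda>y. \<sigma> i y * indicator Q y) x) (p / P i)) \<partial>lebesgue) *
        inverse (\<integral>\<^sup>+x\<in>Q. ennreal (\<Prod>i=1..m. \<sigma> i x powr (p / P i)) \<partial>lebesgue))"

end

theory Submission
  imports Defs
begin

text \<open>
Every cube is contained in a cell of comparable size of one of \<open>2\<^sup>n\<close> shifted dyadic grids
(\<open>one_third_trick\<close>). By monotone convergence it is therefore enough to bound the multilinear
maximal function over a finite family of cells of one grid, with a constant that does not depend on the
family (\<open>multi_maximal_le_grids\<close>, \<open>countable_SUP_integral_le\<close>). All that is used of such a
family is that it is laminar: two of its members are nested or disjoint.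

For a finite laminar family the proof (\<open>laminar_two_weight\<close>) is a linearization followed by a Carleson
embedding. Select the cells at which the product of the means of \<open>f\<^sub>i \<sigma>\<^sub>i\<close> jumps by the factor \<open>(2 * m) ^ m\<close>
(\<open>stopping_subfamily\<close>). The \<open>p\<close>-th power of the maximal function is at most a constant times the sum of
\<open>p\<close>-th powers over the selected cells. The selected cells form a sparse family (\<open>sparse_of_growth\<close>):
each keeps half of its measure after the smaller selected cells are removed. In each cell the
\<open>A\<close>-constant trades \<open>v\<close> for powers of the means of the \<open>\<sigma>\<^sub>i\<close>. By sparseness and the \<open>W\<close>-constant the resulting
coefficients are a Carleson sequence for the measure with density \<open>\<Prod>i. \<sigma>\<^sub>i powr (p / p\<^sub>i)\<close>, and
\<open>carleson_embedding\<close> bounds the sum by the integral of a product of weighted maximal functions of the \<open>f\<^sub>i\<close>.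
Hoelder's inequality (\<open>Hoelder_product\<close>) separates the factors, and the maximal theorem for laminar families
(\<open>laminar_maximal\<close>), whose constant is the same for every measure, bounds each of them.
\<close>

section \<open>Powers, products and Hoelder's inequality for extended nonnegative numbers\<close>

lemma epowr_0 [simp]: "epowr 0 a = 0"
  by (simp add: epowr_def)

lemma epowr_top [simp]: "epowr top a = top"
  by (simp add: epowr_def)

lemma epowr_ennreal: "0 \<le> r \<Longrightarrow> epowr (ennreal r) a = ennreal (r powr a)"
  by (simp add: epowr_def)

lemma epowr_1 [simp]: "epowr x 1 = x"
  by (cases x) (auto simp: epowr_ennreal)

lemma epowr_eq_top_iff [simp]: "epowr x a = top \<longleftrightarrow> x = top"
  by (simp add: epowr_def)

lemma epowr_eq_0_iff [simp]: "epowr x a = 0 \<longleftrightarrow> x = 0"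
  by (cases x) (auto simp: epowr_ennreal ennreal_eq_0_iff)

lemma epowr_mono: "0 \<le> a \<Longrightarrow> x \<le> y \<Longrightarrow> epowr x a \<le> epowr y a"
  by (cases x; cases y) (auto simp: epowr_ennreal top_unique intro!: powr_mono2)

text \<open>
The conventions \<open>0 * top = 0\<close>, \<open>epowr 0 a = 0\<close> and \<open>epowr top a = top\<close> are compatible with
products. Together with the next lemmas this allows all estimates to be carried out in
\<^typ>\<open>ennreal\<close>, where infinite weight constants and infinite norms need no case distinction.
\<close>

lemma epowr_mult: "epowr (x * y) a = epowr x a * epowr y a"
proof -
  consider "x = 0 \<or> y = 0" | "x \<noteq> 0" "y \<noteq> 0" "x = top \<or> y = top"
    | r s where "0 \<le> r" "0 \<le> s" "x = ennreal r" "y = ennreal s"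
    by (cases x; cases y) auto
  then show ?thesis
  proof cases
    case 1
    then show ?thesis by auto
  next
    case 2
    then show ?thesis
      by (auto simp: ennreal_mult_eq_top_iff ennreal_top_mult ennreal_mult_top)
  next
    case 3
    then show ?thesis
      by (simp add: epowr_ennreal powr_mult flip: ennreal_mult)
  qed
qed

lemma epowr_epowr: "epowr (epowr x a) b = epowr x (a * b)"
  by (cases x) (auto simp: epowr_ennreal powr_powr)

lemma epowr_add: "epowr x (a + b) = epowr x a * epowr x b"
  by (cases x) (auto simp: epowr_ennreal powr_add ennreal_mult)

lemma epowr_one_base [simp]: "epowr 1 a = 1"
  using epowr_ennreal[of 1 a] by simp

lemma epowr_prod: "epowr (\<Prod>i\<in>I. g i) a = (\<Prod>i\<in>I. epowr (g i) a)"
  by (induction I rule: infinite_finite_induct) (auto simp: epowr_mult)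

lemma measurable_epowr [measurable (raw)]:
  assumes [measurable]: "g \<in> borel_measurable M"
  shows "(\<lambda>x. epowr (g x) a) \<in> borel_measurable M"
  unfolding epowr_def by measurable

lemma ennreal_prod_mono:
  fixes g h :: "'b \<Rightarrow> ennreal"
  assumes "\<And>i. i \<in> I \<Longrightarrow> g i \<le> h i"
  shows "(\<Prod>i\<in>I. g i) \<le> (\<Prod>i\<in>I. h i)"
  using assms by (induction I rule: infinite_finite_induct) (auto intro!: mult_mono)

text \<open>
Convexity of the exponential function, applied to the logarithms of the \<open>r i\<close>.
\<close>

lemma weighted_AM_GM:
  fixes r \<theta> :: "'b \<Rightarrow> real"
  assumes "finite I" "\<And>i. i \<in> I \<Longrightarrow> 0 \<le> \<theta> i" "(\<Sum>i\<in>I. \<theta> i) = 1" "\<And>i. i \<in> I \<Longrightarrow> 0 \<le> r i"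
  shows "(\<Prod>i\<in>I. r i powr \<theta> i) \<le> (\<Sum>i\<in>I. \<theta> i * r i)"
proof (cases "\<exists>i\<in>I. r i = 0")
  case True
  then have "(\<Prod>i\<in>I. r i powr \<theta> i) = 0"
    using assms(1) by auto
  then show ?thesis using assms by (simp only:) (intro sum_nonneg mult_nonneg_nonneg, auto)
next
  case False
  then have pos: "0 < r i" if "i \<in> I" for i
    using assms(4)[OF that] that by force
  have "(\<Prod>i\<in>I. r i powr \<theta> i) = exp (\<Sum>i\<in>I. \<theta> i *\<^sub>R ln (r i))"
    unfolding exp_sum[OF assms(1)] using pos
    by (intro prod.cong) (auto simp: powr_def dest: pos)
  also have "\<dots> \<le> (\<Sum>i\<in>I. \<theta> i * exp (ln (r i)))"
    using assms by (intro convex_on_sum[OF _ _ exp_convex]) auto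
  also have "\<dots> = (\<Sum>i\<in>I. \<theta> i * r i)"
    using pos by simp
  finally show ?thesis .
qed

lemma ennreal_AM_GM:
  fixes u :: "'b \<Rightarrow> ennreal" and \<theta> :: "'b \<Rightarrow> real"
  assumes "finite I" "\<And>i. i \<in> I \<Longrightarrow> 0 < \<theta> i" "(\<Sum>i\<in>I. \<theta> i) = 1"
  shows "(\<Prod>i\<in>I. epowr (u i) (\<theta> i)) \<le> (\<Sum>i\<in>I. ennreal (\<theta> i) * u i)"
proof (cases "\<exists>i\<in>I. u i = top")
  case True
  then obtain i where i: "i \<in> I" "u i = top" by auto
  have "ennreal (\<theta> i) * u i = top"
    using i assms(2)[of i] by (simp add: ennreal_mult_top)
  then have "(\<Sum>i\<in>I. ennreal (\<theta> i) * u i) = top"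
    using i(1) assms(1) by auto
  then show ?thesis by simp
next
  case False
  define r where "r i = enn2real (u i)" for i
  have u: "u i = ennreal (r i)" if "i \<in> I" for i
    using False that by (auto simp: r_def less_top)
  have r: "0 \<le> r i" for i by (simp add: r_def)
  have "(\<Prod>i\<in>I. epowr (u i) (\<theta> i)) = ennreal (\<Prod>i\<in>I. r i powr \<theta> i)"
    by (simp add: prod_ennreal[symmetric] u epowr_ennreal r cong: prod.cong)
  also have "(\<Prod>i\<in>I. r i powr \<theta> i) \<le> (\<Sum>i\<in>I. \<theta> i * r i)"
    using assms r by (intro weighted_AM_GM) (auto intro: less_imp_le)
  also have "ennreal (\<Sum>i\<in>I. \<theta> i * r i) = (\<Sum>i\<in>I. ennreal (\<theta> i) * u i)"
    using assms(2) r
    by (subst sum_ennreal[symmetric]) (auto simp: u ennreal_mult less_imp_le intro!: sum.cong)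
  finally show ?thesis by (simp add: ennreal_leI)
qed

text \<open>
Dividing each \<open>u i\<close> by its integral reduces the claim to integrals equal to 1, where it is the
integrated weighted arithmetic-geometric mean inequality.
\<close>

lemma Hoelder_product:
  fixes u :: "'b \<Rightarrow> 'a \<Rightarrow> ennreal" and \<theta> :: "'b \<Rightarrow> real"
  assumes fin: "finite I" and \<theta>: "\<And>i. i \<in> I \<Longrightarrow> 0 < \<theta> i" "(\<Sum>i\<in>I. \<theta> i) = 1"
    and u [measurable]: "\<And>i. i \<in> I \<Longrightarrow> u i \<in> borel_measurable M"
  shows "(\<integral>\<^sup>+x. (\<Prod>i\<in>I. epowr (u i x) (\<theta> i)) \<partial>M)
      \<le> (\<Prod>i\<in>I. epowr (\<integral>\<^sup>+x. u i x \<partial>M) (\<theta> i))"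
proof -
  define J where "J i = (\<integral>\<^sup>+x. u i x \<partial>M)" for i
  consider i where "i \<in> I" "J i = 0" | "\<And>i. i \<in> I \<Longrightarrow> J i \<noteq> 0" "\<exists>i\<in>I. J i = top"
    | "\<And>i. i \<in> I \<Longrightarrow> J i \<noteq> 0" "\<And>i. i \<in> I \<Longrightarrow> J i \<noteq> top" by metis
  then show ?thesis
  proof cases
    case 1
    have "AE x in M. u i x = 0"
      using 1 by (simp add: J_def nn_integral_0_iff_AE)
    then have "AE x in M. (\<Prod>i\<in>I. epowr (u i x) (\<theta> i)) = 0"
      by eventually_elim (use fin 1 in \<open>auto simp: prod_zero_iff\<close>)
    then have "(\<integral>\<^sup>+x. (\<Prod>i\<in>I. epowr (u i x) (\<theta> i)) \<partial>M) = (\<integral>\<^sup>+x. 0 \<partial>M)"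
      by (intro nn_integral_cong_AE) auto
    then show ?thesis by simp
  next
    case 2
    then have "(\<Prod>i\<in>I. epowr (J i) (\<theta> i)) = top"
      using fin by (subst ennreal_prod_eq_top) auto
    then show ?thesis by (simp add: J_def)
  next
    case 3
    have cancel: "epowr (u i x) (\<theta> i) = epowr (J i) (\<theta> i) * epowr (u i x / J i) (\<theta> i)" if "i \<in> I" for i x
    proof -
      have "u i x = J i * (u i x / J i)"
        using 3[OF that] by (simp add: ennreal_times_divide mult_divide_eq_ennreal mult.commute[of "J i"])
      then show ?thesis by (metis epowr_mult)
    qed
    have "(\<integral>\<^sup>+x. (\<Prod>i\<in>I. epowr (u i x) (\<theta> i)) \<partial>M)
        = (\<integral>\<^sup>+x. (\<Prod>i\<in>I. epowr (J i) (\<theta> i)) * (\<Prod>i\<in>I. epowr (u i x / J i) (\<theta> i)) \<partial>M)"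
      by (intro nn_integral_cong) (simp add: cancel prod.distrib cong: prod.cong)
    also have "\<dots> = (\<Prod>i\<in>I. epowr (J i) (\<theta> i)) * (\<integral>\<^sup>+x. (\<Prod>i\<in>I. epowr (u i x / J i) (\<theta> i)) \<partial>M)"
      by (rule nn_integral_cmult) measurable
    also have "(\<integral>\<^sup>+x. (\<Prod>i\<in>I. epowr (u i x / J i) (\<theta> i)) \<partial>M)
        \<le> (\<integral>\<^sup>+x. (\<Sum>i\<in>I. ennreal (\<theta> i) * (u i x / J i)) \<partial>M)"
      by (intro nn_integral_mono ennreal_AM_GM fin \<theta>)
    also have "\<dots> = (\<Sum>i\<in>I. ennreal (\<theta> i) * (J i / J i))"
      by (simp add: nn_integral_sum nn_integral_cmult nn_integral_divide J_def)
    also have "\<dots> = (\<Sum>i\<in>I. ennreal (\<theta> i))"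
      using 3 by (intro sum.cong) (auto simp: ennreal_divide_self less_top)
    also have "\<dots> = 1"
      using \<theta> by (subst sum_ennreal) (auto simp: less_imp_le)
    finally show ?thesis by (simp add: J_def mult_left_mono)
  qed
qed

section \<open>Stopping families\<close>

text \<open>
The principal cubes of a finite family. Going through the family from large sets to small ones, a set
is selected exactly when no selected superset controls its value \<open>\<phi>\<close> up to the factor \<open>a\<close>; so every
set is controlled by a selected one, and along chains of selected sets \<open>\<phi>\<close> grows geometrically. This
one construction is used three times: for the maximal theorem, for the Carleson embedding and for the
sparse family that linearizes the multilinear maximal function.
\<close>

lemma stopping_subfamily:
  fixes \<phi> :: "'a set \<Rightarrow> ennreal" and a :: ennreal
  assumes "finite F" "1 \<le> a"
  obtains S where "S \<subseteq> F"
    "\<And>Q. Q \<in> F \<Longrightarrow> \<exists>R\<in>S. Q \<subseteq> R \<and> \<phi> Q \<le> a * \<phi> R"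
    "\<And>Q R. Q \<in> S \<Longrightarrow> R \<in> S \<Longrightarrow> Q \<subset> R \<Longrightarrow> a * \<phi> R < \<phi> Q"
proof -
  have "\<exists>S\<subseteq>F. (\<forall>Q\<in>F. \<exists>R\<in>S. Q \<subseteq> R \<and> \<phi> Q \<le> a * \<phi> R)
      \<and> (\<forall>Q\<in>S. \<forall>R\<in>S. Q \<subset> R \<longrightarrow> a * \<phi> R < \<phi> Q)"
    using assms(1)
  proof (induction F rule: finite_psubset_induct)
    case (psubset F)
    show ?case
    proof (cases "F = {}")
      case False
      obtain Q0 where Q0: "Q0 \<in> F" "\<And>Q. Q \<in> F \<Longrightarrow> Q \<subseteq> Q0 \<Longrightarrow> Q = Q0"
        using finite_has_minimal[OF psubset(1) False] by metis
      obtain S where S: "S \<subseteq> F - {Q0}"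
        "\<And>Q. Q \<in> F - {Q0} \<Longrightarrow> \<exists>R\<in>S. Q \<subseteq> R \<and> \<phi> Q \<le> a * \<phi> R"
        "\<And>Q R. Q \<in> S \<Longrightarrow> R \<in> S \<Longrightarrow> Q \<subset> R \<Longrightarrow> a * \<phi> R < \<phi> Q"
      proof -
        have "F - {Q0} \<subset> F" using Q0(1) by blast
        from psubset.IH[OF this] show thesis
          using that by (elim exE conjE) (rule that, auto)
      qed
      show ?thesis
      proof (cases "\<exists>R\<in>S. Q0 \<subseteq> R \<and> \<phi> Q0 \<le> a * \<phi> R")
        case True
        have "\<exists>R\<in>S. Q \<subseteq> R \<and> \<phi> Q \<le> a * \<phi> R" if "Q \<in> F" for Q
          using S(2)[of Q] that True by (cases "Q = Q0") simp_all
        then show ?thesis using S(1,3) by (intro exI[of _ S]) auto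
      next
        case new: False
        have self: "\<phi> Q0 \<le> a * \<phi> Q0"
          using mult_right_mono[OF assms(2), of "\<phi> Q0"] by simp
        have "\<not> Q0 \<supset> Q" if "Q \<in> S" for Q
          using Q0(2)[of Q] S(1) that by blast
        moreover have "a * \<phi> R < \<phi> Q0" if "R \<in> S" "Q0 \<subset> R" for R
          using new that by (meson not_le psubset_imp_subset)
        ultimately have "\<forall>Q\<in>insert Q0 S. \<forall>R\<in>insert Q0 S. Q \<subset> R \<longrightarrow> a * \<phi> R < \<phi> Q"
          using S(3) by blast
        moreover have "\<exists>R\<in>insert Q0 S. Q \<subseteq> R \<and> \<phi> Q \<le> a * \<phi> R" if "Q \<in> F" for Q
        proof (cases "Q = Q0")
          case True
          then show ?thesis using self by blast
        next
          case False
          then show ?thesis using S(2)[of Q] that by blast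
        qed
        moreover have "insert Q0 S \<subseteq> F" using S(1) Q0(1) by blast
        ultimately show ?thesis by (intro exI[of _ "insert Q0 S"]) simp
      qed
    qed auto
  qed
  then show ?thesis by (elim exE conjE) (rule that, auto)
qed

text \<open>
Ordered by size the terms at least double from each to the next, so all terms below the largest one add
up to at most the largest one.
\<close>

lemma sum_doubling_le:
  fixes \<phi> :: "'b \<Rightarrow> ennreal"
  assumes "finite T" "\<And>Q. Q \<in> T \<Longrightarrow> \<phi> Q \<le> B"
    and "\<And>Q R. Q \<in> T \<Longrightarrow> R \<in> T \<Longrightarrow> Q \<noteq> R \<Longrightarrow> 2 * \<phi> R \<le> \<phi> Q \<or> 2 * \<phi> Q \<le> \<phi> R"
  shows "(\<Sum>Q\<in>T. \<phi> Q) \<le> 2 * B"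
  using assms
proof (induction T arbitrary: B rule: finite_ranking_induct[where f = \<phi>])
  case (insert Q T)
  show ?case
  proof (cases "Q \<in> T")
    case True
    then show ?thesis using insert by (simp add: insert_absorb)
  next
    case False
    have "2 * \<phi> R \<le> \<phi> Q" if "R \<in> T" for R
    proof -
      have "2 * \<phi> R \<le> \<phi> Q \<or> 2 * \<phi> Q \<le> \<phi> R"
        using insert.prems(2)[of Q R] that False by auto
      moreover have "2 * \<phi> R \<le> 2 * \<phi> Q"
        using insert.hyps(2)[OF that] by (intro mult_left_mono) auto
      moreover have "\<phi> R \<le> \<phi> Q" by (rule insert.hyps(2)[OF that])
      ultimately show ?thesis by (meson order_trans)
    qed
    moreover have two: "2 * (\<phi> Q / 2) = \<phi> Q"
      by (simp add: ennreal_times_divide mult_divide_eq_ennreal mult.commute[of 2])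
    ultimately have half: "\<phi> R \<le> \<phi> Q / 2" if "R \<in> T" for R
      using that ennreal_mult_le_mult_iff[of 2 "\<phi> R" "\<phi> Q / 2"] by simp
    have "(\<Sum>R\<in>T. \<phi> R) \<le> 2 * (\<phi> Q / 2)"
      using insert.prems half by (intro insert.IH) auto
    also note two
    finally have "(\<Sum>R\<in>insert Q T. \<phi> R) \<le> \<phi> Q + \<phi> Q"
      using False insert.hyps(1) by (simp add: add_left_mono)
    also have "\<dots> \<le> 2 * B"
      using insert.prems(1)[of Q] by (simp add: mult_2[symmetric] mult_left_mono)
    finally show ?thesis .
  qed
qed auto

section \<open>Laminar families and the weighted maximal theorem\<close>

definition laminar :: "'a set set \<Rightarrow> bool" where
  "laminar F \<longleftrightarrow> (\<forall>Q\<in>F. \<forall>R\<in>F. Q \<subseteq> R \<or> R \<subseteq> Q \<or> Q \<inter> R = {})"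

definition mean :: "'a measure \<Rightarrow> ('a \<Rightarrow> ennreal) \<Rightarrow> 'a set \<Rightarrow> ennreal" where
  "mean M u Q = (\<integral>\<^sup>+x\<in>Q. u x \<partial>M) / emeasure M Q"

lemma laminar_subset: "laminar F \<Longrightarrow> S \<subseteq> F \<Longrightarrow> laminar S"
  unfolding laminar_def by blast

lemma laminarD: "laminar F \<Longrightarrow> Q \<in> F \<Longrightarrow> R \<in> F \<Longrightarrow> x \<in> Q \<Longrightarrow> x \<in> R \<Longrightarrow> Q \<subseteq> R \<or> R \<subseteq> Q"
  unfolding laminar_def by blast

lemma mean_times_emeasure:
  assumes "0 < emeasure M Q" "emeasure M Q < top"
  shows "mean M u Q * emeasure M Q = (\<integral>\<^sup>+x\<in>Q. u x \<partial>M)"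
  using assms unfolding mean_def
  by (simp add: ennreal_divide_times)

text \<open>
The weak type estimate for the maximal function of a laminar family: the maximal members of the family
are disjoint and have the same union, so the estimates for single sets can be added.
\<close>

lemma laminar_weak_type:
  assumes "finite C" "laminar C" "C \<subseteq> sets M" and [measurable]: "u \<in> borel_measurable M"
    and le: "\<And>Q. Q \<in> C \<Longrightarrow> t * emeasure M Q \<le> (\<integral>\<^sup>+x\<in>Q. u x \<partial>M)"
  shows "t * emeasure M (\<Union>C) \<le> (\<integral>\<^sup>+x\<in>\<Union>C. u x \<partial>M)"
proof -
  define D where "D = {Q\<in>C. \<forall>R\<in>C. Q \<subseteq> R \<longrightarrow> Q = R}"
  have D: "finite D" "D \<subseteq> C" using assms(1) by (auto simp: D_def)
  have "\<exists>R\<in>D. Q \<subseteq> R" if Q: "Q \<in> C" for Q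
  proof -
    obtain R where "R \<in> C" "Q \<subseteq> R" "\<forall>R'\<in>C. R \<subseteq> R' \<longrightarrow> R = R'"
      using finite_has_maximal2[OF assms(1) Q] by metis
    then show ?thesis by (auto simp: D_def)
  qed
  then have Un: "\<Union>C = (\<Union>Q\<in>D. Q)" using D(2) by blast
  have disj: "disjoint_family_on (\<lambda>Q. Q) D"
    unfolding disjoint_family_on_def
  proof (intro ballI impI)
    fix Q R assume *: "Q \<in> D" "R \<in> D" "Q \<noteq> R"
    then have "\<not> Q \<subseteq> R" "\<not> R \<subseteq> Q" by (auto simp: D_def)
    then show "Q \<inter> R = {}" using assms(2) D(2) * unfolding laminar_def by blast
  qed
  have sets: "(\<lambda>Q. Q) ` D \<subseteq> sets M" using D assms(3) by auto
  have dens: "(\<integral>\<^sup>+x\<in>Q. u x \<partial>M) = emeasure (density M u) Q" if "Q \<in> sets M" for Q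
    using that by (simp add: emeasure_density)
  have "t * emeasure M (\<Union>C) = (\<Sum>Q\<in>D. t * emeasure M Q)"
    unfolding Un sum_emeasure[OF sets disj D(1), symmetric] by (simp add: sum_distrib_left)
  also have "\<dots> \<le> (\<Sum>Q\<in>D. emeasure (density M u) Q)"
  proof (rule sum_mono)
    fix Q assume "Q \<in> D"
    then show "t * emeasure M Q \<le> emeasure (density M u) Q"
      using le[of Q] D(2) assms(3) by (subst dens[symmetric]) auto
  qed
  also have "\<dots> = emeasure (density M u) (\<Union>C)"
    unfolding Un using sets by (intro sum_emeasure disj D(1)) auto
  also have "\<dots> = (\<integral>\<^sup>+x\<in>\<Union>C. u x \<partial>M)"
    using assms(1,3) by (intro dens[symmetric]) auto
  finally show ?thesis .
qed

lemma stopping_sum_le: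
  fixes \<phi> :: "'a set \<Rightarrow> ennreal"
  assumes "finite T" "laminar T"
    and grow: "\<And>Q R. Q \<in> T \<Longrightarrow> R \<in> T \<Longrightarrow> Q \<subset> R \<Longrightarrow> 2 * \<phi> R < \<phi> Q"
    and le: "\<And>Q. Q \<in> T \<Longrightarrow> x \<in> Q \<Longrightarrow> \<phi> Q \<le> B"
  shows "(\<Sum>Q\<in>T. \<phi> Q * indicator Q x) \<le> 2 * B"
proof -
  have "(\<Sum>Q\<in>T. \<phi> Q * indicator Q x) = (\<Sum>Q | Q \<in> T \<and> x \<in> Q. \<phi> Q)"
    using assms(1) by (intro sum.mono_neutral_cong_right) (auto simp: indicator_def)
  also have "\<dots> \<le> 2 * B"
  proof (rule sum_doubling_le)
    fix Q R assume *: "Q \<in> {Q \<in> T. x \<in> Q}" "R \<in> {Q \<in> T. x \<in> Q}" "Q \<noteq> R"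
    then have "Q \<subset> R \<or> R \<subset> Q"
      using laminarD[OF assms(2), of Q R x] by auto
    then show "2 * \<phi> R \<le> \<phi> Q \<or> 2 * \<phi> Q \<le> \<phi> R"
      using grow[of Q R] grow[of R Q] * by (elim disjE) (simp_all add: less_imp_le)
  qed (use assms(1) le in auto)
  finally show ?thesis .
qed

text \<open>
The form of Young's inequality that is used to absorb the maximal function into the left-hand side.
The two terms on the right come from the cases \<open>h \<le> \<epsilon> * g powr (1 / q)\<close> and its converse.
\<close>

lemma Young_split:
  fixes h g :: ennreal
  assumes "1 < q" "0 < \<epsilon>"
  shows "h * epowr g ((q - 1) / q) \<le> ennreal \<epsilon> * g + ennreal (\<epsilon> powr (1 - q)) * epowr h q"
proof (cases "h \<le> ennreal \<epsilon> * epowr g (1 / q)")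
  case True
  then have "h * epowr g ((q - 1) / q) \<le> ennreal \<epsilon> * (epowr g (1 / q) * epowr g ((q - 1) / q))"
    by (metis mult.assoc mult_right_mono zero_le)
  also have "\<dots> = ennreal \<epsilon> * g"
    using assms(1) by (simp add: diff_divide_distrib flip: epowr_add)
  finally show ?thesis
    by (meson add_increasing2 order_trans zero_le le_add_same_cancel1)
next
  case False
  have inv: "ennreal (1 / \<epsilon>) * ennreal \<epsilon> = 1"
    using assms(2) by (simp flip: ennreal_mult)
  have "epowr g (1 / q) = ennreal (1 / \<epsilon>) * (ennreal \<epsilon> * epowr g (1 / q))"
    using inv by (simp flip: mult.assoc)
  also have "\<dots> \<le> ennreal (1 / \<epsilon>) * h"
    using False by (intro mult_left_mono) auto
  finally have "epowr (epowr g (1 / q)) (q - 1) \<le> epowr (ennreal (1 / \<epsilon>) * h) (q - 1)"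
    using assms by (intro epowr_mono) auto
  moreover have "(1 / \<epsilon>) powr (q - 1) = \<epsilon> powr (1 - q)"
    using assms(2) by (simp add: powr_divide powr_minus_divide[of \<epsilon> "q - 1", symmetric])
  ultimately have "epowr g ((q - 1) / q) \<le> ennreal (\<epsilon> powr (1 - q)) * epowr h (q - 1)"
    using assms by (simp add: epowr_mult epowr_epowr epowr_ennreal)
  then have "h * epowr g ((q - 1) / q) \<le> h * (ennreal (\<epsilon> powr (1 - q)) * epowr h (q - 1))"
    by (intro mult_left_mono) auto
  also have "\<dots> = ennreal (\<epsilon> powr (1 - q)) * epowr h q"
    using epowr_add[of h 1 "q - 1"] by (simp add: mult_ac)
  finally show ?thesis
    by (meson add_increasing order_trans zero_le le_add_same_cancel2)
qed

definition maximal_const :: "real \<Rightarrow> real" where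
  "maximal_const q = (4 * 2 powr (q / (q - 1))) powr q"

text \<open>
Let \<open>G\<close> be the \<open>q\<close>-th power of the maximal function. The stopping family is taken with respect to the
power \<open>q - 1\<close> of the means, because then
\<open>(mean R) powr q * N R = (mean R) powr (q - 1) * (\<integral>\<^sub>R h)\<close> shows that
\<open>\<integral> G \<lesssim> \<integral> h * (\<Sum>R. (mean R) powr (q - 1) * 1\<^sub>R)\<close>, and the sum is geometric at every point, hence bounded
by twice \<open>G powr ((q - 1) / q)\<close>. Young's inequality leaves a multiple of \<open>\<integral> h powr q\<close> and one half of
\<open>\<integral> G\<close>, which can be subtracted since it is finite for a finite family. The constant depends only on
\<open>q\<close>, so the lemma can be applied to the measures \<open>\<sigma>\<^sub>i dx\<close> with a bound independent of the weights.
\<close>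

lemma laminar_maximal:
  assumes q: "1 < q" and F: "finite F" "laminar F"
    and Q: "\<And>Q. Q \<in> F \<Longrightarrow> Q \<in> sets N" "\<And>Q. Q \<in> F \<Longrightarrow> 0 < emeasure N Q" "\<And>Q. Q \<in> F \<Longrightarrow> emeasure N Q < top"
    and h [measurable]: "h \<in> borel_measurable N"
  shows "(\<integral>\<^sup>+x. (SUP Q\<in>F. epowr (mean N h Q) q * indicator Q x) \<partial>N)
      \<le> ennreal (maximal_const q) * (\<integral>\<^sup>+x. epowr (h x) q \<partial>N)"
proof -
  define G where "G x = (SUP Q\<in>F. epowr (mean N h Q) q * indicator Q x)" for x
  define H where "H = (\<integral>\<^sup>+x. epowr (h x) q \<partial>N)"
  define K where "K = (2::real) powr (q / (q - 1))"
  \<comment> \<open>With this choice the coefficient \<open>2 * K * \<epsilon>\<close> of \<open>\<integral> G\<close> on the right-hand side is one half.\<close>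
  define \<epsilon> where "\<epsilon> = 1 / (4 * K)"
  have K: "0 < K" by (simp add: K_def)
  then have \<epsilon>: "0 < \<epsilon>" by (simp add: \<epsilon>_def)
  note [measurable] = Q(1)
  have [measurable]: "G \<in> borel_measurable N"
    unfolding G_def using F(1) by (intro borel_measurable_SUP countable_finite) measurable
  have const: "maximal_const q = 4 * K * \<epsilon> powr (1 - q)"
  proof -
    have "\<epsilon> powr (1 - q) = (4 * K) powr (q - 1)"
    proof -
      have "\<epsilon> = (4 * K) powr (- 1)" using K by (simp add: \<epsilon>_def powr_minus_divide)
      then show ?thesis by (simp only: powr_powr) simp
    qed
    then show ?thesis
      using K powr_add[of "4 * K" 1 "q - 1"] by (simp add: maximal_const_def K_def)
  qed
  show ?thesis
  proof (cases "H = top")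
    case True
    have "0 < maximal_const q" using K \<epsilon> by (simp add: const)
    then have "ennreal (maximal_const q) * H = top"
      using True by (simp add: ennreal_mult_top)
    then show ?thesis by (simp add: H_def)
  next
    case Hfin: False
    have mean_fin: "mean N h Q < top" if "Q \<in> F" for Q
    proof -
      have pt: "y \<le> 1 + epowr y q" for y
      proof (cases y)
        case (real r)
        have "r \<le> 1 + r powr q"
        proof (cases "r \<le> 1")
          case False
          then show ?thesis using q powr_mono[of 1 q r] by simp
        qed (simp add: add_increasing2)
        then show ?thesis
          using real by (simp add: epowr_ennreal ennreal_plus[symmetric] ennreal_leI flip: ennreal_1 del: ennreal_plus)
      qed auto
      have "(\<integral>\<^sup>+x\<in>Q. h x \<partial>N) \<le> (\<integral>\<^sup>+x. indicator Q x + epowr (h x) q \<partial>N)"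
        using pt by (intro nn_integral_mono) (auto simp: indicator_def)
      also have "\<dots> = emeasure N Q + H"
        using that by (subst nn_integral_add) (auto simp: H_def)
      also have "\<dots> < top" using Q(3)[OF that] Hfin by (simp add: less_top)
      finally show ?thesis
        using Q(2)[OF that] unfolding mean_def by (auto simp: ennreal_divide_eq_top_iff less_top[symmetric])
    qed
    have Gfin: "(\<integral>\<^sup>+x. G x \<partial>N) < top"
    proof -
      have "(\<integral>\<^sup>+x. G x \<partial>N) \<le> (\<integral>\<^sup>+x. (\<Sum>Q\<in>F. epowr (mean N h Q) q * indicator Q x) \<partial>N)"
        unfolding G_def using F(1) by (intro nn_integral_mono SUP_least member_le_sum) auto
      also have "\<dots> = (\<Sum>Q\<in>F. epowr (mean N h Q) q * emeasure N Q)"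
        using Q(1) by (subst nn_integral_sum) (auto simp: nn_integral_cmult_indicator)
      also have "\<dots> < top"
        using F(1) mean_fin Q(3) by (auto simp: ennreal_mult_eq_top_iff less_top[symmetric])
      finally show ?thesis .
    qed
    define \<phi> where "\<phi> Q = epowr (mean N h Q) (q - 1)" for Q
    obtain T where T: "T \<subseteq> F"
      "\<And>Q. Q \<in> F \<Longrightarrow> \<exists>R\<in>T. Q \<subseteq> R \<and> \<phi> Q \<le> 2 * \<phi> R"
      "\<And>Q R. Q \<in> T \<Longrightarrow> R \<in> T \<Longrightarrow> Q \<subset> R \<Longrightarrow> 2 * \<phi> R < \<phi> Q"
      using stopping_subfamily[OF F(1), of 2 \<phi>] by auto
    have finT: "finite T" using T(1) F(1) finite_subset by blast
    note [measurable] = Q(1)[OF subsetD[OF T(1)]]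
    have dom: "G x \<le> ennreal K * (\<Sum>R\<in>T. epowr (mean N h R) q * indicator R x)" for x
      unfolding G_def
    proof (rule SUP_least)
      fix Q assume "Q \<in> F"
      show "epowr (mean N h Q) q * indicator Q x \<le> ennreal K * (\<Sum>R\<in>T. epowr (mean N h R) q * indicator R x)"
      proof (cases "x \<in> Q")
        case True
        obtain R where R: "R \<in> T" "Q \<subseteq> R" "\<phi> Q \<le> 2 * \<phi> R" using T(2)[OF \<open>Q \<in> F\<close>] by auto
        have two: "epowr 2 a = ennreal (2 powr a)" for a
          using epowr_ennreal[of 2 a] by simp
        \<comment> \<open>The stopping rule compares powers \<open>q - 1\<close> of the means; raising to \<open>q / (q - 1)\<close> gives the power \<open>q\<close>.\<close>
        have "epowr (\<phi> Q) (q / (q - 1)) \<le> epowr (2 * \<phi> R) (q / (q - 1))"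
          using R(3) q by (intro epowr_mono) auto
        then have "epowr (mean N h Q) q \<le> ennreal K * epowr (mean N h R) q"
          using q by (simp add: \<phi>_def epowr_mult epowr_epowr two K_def)
        also have "\<dots> = ennreal K * (epowr (mean N h R) q * indicator R x)"
          using True R(2) by (auto simp: indicator_def)
        also have "\<dots> \<le> ennreal K * (\<Sum>R\<in>T. epowr (mean N h R) q * indicator R x)"
          using R(1) finT by (intro mult_left_mono member_le_sum[where f = "\<lambda>R. epowr (mean N h R) q * indicator R x"]) auto
        finally show ?thesis using True by simp
      qed simp
    qed
    have pointwise: "(\<Sum>R\<in>T. \<phi> R * indicator R x) \<le> 2 * epowr (G x) ((q - 1) / q)" for x
    proof (rule stopping_sum_le[OF finT laminar_subset[OF F(2) T(1)] T(3)])
      fix R assume "R \<in> T" "x \<in> R"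
      then have "epowr (mean N h R) q \<le> G x"
        unfolding G_def using T(1) by (intro SUP_upper2[of R]) auto
      then have "epowr (epowr (mean N h R) q) ((q - 1) / q) \<le> epowr (G x) ((q - 1) / q)"
        using q by (intro epowr_mono) auto
      then show "\<phi> R \<le> epowr (G x) ((q - 1) / q)"
        using q by (simp add: epowr_epowr \<phi>_def)
    qed
    have summand: "epowr (mean N h R) q * emeasure N R = (\<integral>\<^sup>+x. h x * (\<phi> R * indicator R x) \<partial>N)" if "R \<in> T" for R
    proof -
      have RF: "R \<in> F" using that T(1) by auto
      have "epowr (mean N h R) q * emeasure N R = \<phi> R * (mean N h R * emeasure N R)"
        using epowr_add[of "mean N h R" "q - 1" 1] by (simp add: \<phi>_def mult_ac)
      also have "\<dots> = \<phi> R * (\<integral>\<^sup>+x\<in>R. h x \<partial>N)"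
        using mean_times_emeasure[OF Q(2,3)[OF RF]] by simp
      also have "\<dots> = (\<integral>\<^sup>+x. \<phi> R * (h x * indicator R x) \<partial>N)"
        using h Q(1)[OF RF]
        by (intro nn_integral_cmult[symmetric] borel_measurable_times_ennreal borel_measurable_indicator)
      finally show ?thesis by (simp add: mult_ac)
    qed
    have "(\<integral>\<^sup>+x. G x \<partial>N) \<le> (\<integral>\<^sup>+x. ennreal K * (\<Sum>R\<in>T. epowr (mean N h R) q * indicator R x) \<partial>N)"
      by (intro nn_integral_mono dom)
    also have "\<dots> = ennreal K * (\<Sum>R\<in>T. epowr (mean N h R) q * emeasure N R)"
      using T(1) Q(1) by (subst nn_integral_cmult) (auto simp: nn_integral_sum nn_integral_cmult_indicator subset_iff)
    also have "\<dots> = ennreal K * (\<integral>\<^sup>+x. h x * (\<Sum>R\<in>T. \<phi> R * indicator R x) \<partial>N)"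
      by (simp add: summand nn_integral_sum sum_distrib_left cong: sum.cong)
    also have "\<dots> \<le> ennreal K * (\<integral>\<^sup>+x. 2 * (ennreal \<epsilon> * G x + ennreal (\<epsilon> powr (1 - q)) * epowr (h x) q) \<partial>N)"
    proof (intro mult_left_mono nn_integral_mono)
      fix x
      have "h x * (\<Sum>R\<in>T. \<phi> R * indicator R x) \<le> h x * (2 * epowr (G x) ((q - 1) / q))"
        by (intro mult_left_mono pointwise) auto
      also have "\<dots> = 2 * (h x * epowr (G x) ((q - 1) / q))" by (simp add: mult_ac)
      also have "\<dots> \<le> 2 * (ennreal \<epsilon> * G x + ennreal (\<epsilon> powr (1 - q)) * epowr (h x) q)"
        by (intro mult_left_mono Young_split q \<epsilon>) auto
      finally show "h x * (\<Sum>R\<in>T. \<phi> R * indicator R x) \<le> \<dots>" .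
    qed auto
    also have "\<dots> = ennreal K * (2 * (ennreal \<epsilon> * (\<integral>\<^sup>+x. G x \<partial>N) + ennreal (\<epsilon> powr (1 - q)) * H))"
      by (simp add: nn_integral_cmult nn_integral_add H_def)
    finally have main: "(\<integral>\<^sup>+x. G x \<partial>N) \<le> \<dots>" .
    obtain X where X: "(\<integral>\<^sup>+x. G x \<partial>N) = ennreal X" "0 \<le> X"
      using Gfin by (cases "\<integral>\<^sup>+x. G x \<partial>N") auto
    obtain Y where Y: "H = ennreal Y" "0 \<le> Y" using Hfin by (cases H) auto
    have "ennreal X \<le> ennreal (K * (2 * (\<epsilon> * X + \<epsilon> powr (1 - q) * Y)))"
      using main K \<epsilon> X(2) Y(2) unfolding X(1) Y(1) by (simp add: ennreal_mult)
    then have "X \<le> K * (2 * (\<epsilon> * X + \<epsilon> powr (1 - q) * Y))"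
      using K \<epsilon> X(2) Y(2) by (subst (asm) ennreal_le_iff) auto
    also have "\<dots> = X / 2 + 2 * K * \<epsilon> powr (1 - q) * Y"
    proof -
      have "K * \<epsilon> = 1 / 4" using K by (simp add: \<epsilon>_def)
      then show ?thesis by (simp add: distrib_left mult.assoc[symmetric] mult.commute[of K 2])
    qed
    finally have "X \<le> maximal_const q * Y"
      by (simp add: const)
    then have "ennreal X \<le> ennreal (maximal_const q) * ennreal Y"
      by (simp add: maximal_const_def Y(2) ennreal_leI flip: ennreal_mult)
    then show ?thesis using X Y by (simp add: G_def H_def)
  qed
qed

section \<open>Carleson embedding and sparseness\<close>

text \<open>
A stopping family \<open>T\<close> for \<open>\<psi>\<close> replaces \<open>\<psi> Q\<close> by the value at a stopping set \<open>R \<supseteq> Q\<close>. The coefficients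
below \<open>R\<close> then add up to at most \<open>K * \<mu> R\<close>, and \<open>\<Sum>R\<in>T. \<psi> R * \<mu> R\<close> is the integral of a sum that is geometric
at every point.
\<close>

lemma carleson_embedding:
  fixes \<psi> b :: "'a set \<Rightarrow> ennreal"
  assumes S: "finite S" "laminar S" "S \<subseteq> sets \<mu>"
    and carleson: "\<And>R. R \<in> S \<Longrightarrow> (\<Sum>Q | Q \<in> S \<and> Q \<subseteq> R. b Q) \<le> K * emeasure \<mu> R"
  shows "(\<Sum>Q\<in>S. \<psi> Q * b Q) \<le> 4 * K * (\<integral>\<^sup>+x. (SUP Q\<in>S. \<psi> Q * indicator Q x) \<partial>\<mu>)"
proof -
  obtain T where T: "T \<subseteq> S"
    "\<And>Q. Q \<in> S \<Longrightarrow> \<exists>R\<in>T. Q \<subseteq> R \<and> \<psi> Q \<le> 2 * \<psi> R"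
    "\<And>Q R. Q \<in> T \<Longrightarrow> R \<in> T \<Longrightarrow> Q \<subset> R \<Longrightarrow> 2 * \<psi> R < \<psi> Q"
    using stopping_subfamily[OF S(1), of 2 \<psi>] by auto
  have finT: "finite T" using T(1) S(1) finite_subset by blast
  have sets: "R \<in> sets \<mu>" if "R \<in> T" for R using that T(1) S(3) by auto
  have "(\<Sum>Q\<in>S. \<psi> Q * b Q) \<le> (\<Sum>Q\<in>S. \<Sum>R\<in>T. 2 * \<psi> R * (if Q \<subseteq> R then b Q else 0))"
  proof (rule sum_mono)
    fix Q assume "Q \<in> S"
    then obtain R where R: "R \<in> T" "Q \<subseteq> R" "\<psi> Q \<le> 2 * \<psi> R" using T(2) by blast
    have "\<psi> Q * b Q \<le> 2 * \<psi> R * (if Q \<subseteq> R then b Q else 0)"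
      using R by (simp add: mult_right_mono)
    also have "\<dots> \<le> (\<Sum>R\<in>T. 2 * \<psi> R * (if Q \<subseteq> R then b Q else 0))"
      using R(1) finT by (intro member_le_sum[where f = "\<lambda>R. 2 * \<psi> R * (if Q \<subseteq> R then b Q else 0)"]) auto
    finally show "\<psi> Q * b Q \<le> \<dots>" .
  qed
  also have "\<dots> = (\<Sum>R\<in>T. 2 * \<psi> R * (\<Sum>Q | Q \<in> S \<and> Q \<subseteq> R. b Q))"
    by (subst sum.swap) (simp add: S(1) sum_distrib_left[symmetric] sum.inter_filter)
  also have "\<dots> \<le> (\<Sum>R\<in>T. 2 * \<psi> R * (K * emeasure \<mu> R))"
    using T(1) by (intro sum_mono mult_left_mono carleson) auto
  also have "\<dots> = 2 * K * (\<integral>\<^sup>+x. (\<Sum>R\<in>T. \<psi> R * indicator R x) \<partial>\<mu>)"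
    using sets by (simp add: nn_integral_sum nn_integral_cmult_indicator sum_distrib_left mult_ac)
  also have "\<dots> \<le> 2 * K * (\<integral>\<^sup>+x. 2 * (SUP Q\<in>S. \<psi> Q * indicator Q x) \<partial>\<mu>)"
  proof (intro mult_left_mono nn_integral_mono stopping_sum_le finT laminar_subset[OF S(2) T(1)] T(3))
    fix x R assume "R \<in> T" "x \<in> R"
    then show "\<psi> R \<le> (SUP Q\<in>S. \<psi> Q * indicator Q x)"
      using T(1) by (intro SUP_upper2[of R]) auto
  qed auto
  also have "\<dots> = 2 * K * (2 * (\<integral>\<^sup>+x. (SUP Q\<in>S. \<psi> Q * indicator Q x) \<partial>\<mu>))"
    using S by (subst nn_integral_cmult) (auto intro!: borel_measurable_SUP countable_finite)
  also have "\<dots> = 4 * K * (\<integral>\<^sup>+x. (SUP Q\<in>S. \<psi> Q * indicator Q x) \<partial>\<mu>)"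
  proof -
    have "2 * K * (2 * z) = 4 * K * z" for z :: ennreal
    proof -
      have "2 * K * (2 * z) = (2 * 2) * K * z" by (simp only: mult_ac)
      then show ?thesis by simp
    qed
    then show ?thesis .
  qed
  finally show ?thesis .
qed

text \<open>
If a product of \<open>n\<close> means exceeds \<open>(2 * n) ^ n\<close> times the product over a larger set \<open>R\<close>, then one of the
factors exceeds \<open>2 * n\<close> times its mean over \<open>R\<close>. By the weak type estimate the members of the family
where the \<open>i\<close>-th factor does so cover at most the fraction \<open>1 / (2 * n)\<close> of \<open>R\<close>, and summing over the \<open>n\<close>
factors leaves half of \<open>R\<close> uncovered.
\<close>

lemma sparse_of_growth:
  fixes g :: "'b \<Rightarrow> 'a \<Rightarrow> ennreal"
  assumes S: "finite S" "laminar S"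
    and Q: "\<And>Q. Q \<in> S \<Longrightarrow> Q \<in> sets M" "\<And>Q. Q \<in> S \<Longrightarrow> 0 < emeasure M Q" "\<And>Q. Q \<in> S \<Longrightarrow> emeasure M Q < top"
    and I: "finite I" "I \<noteq> {}"
    and g [measurable]: "\<And>i. i \<in> I \<Longrightarrow> g i \<in> borel_measurable M"
    and grow: "\<And>Q R. Q \<in> S \<Longrightarrow> R \<in> S \<Longrightarrow> Q \<subset> R \<Longrightarrow>
        (\<Prod>i\<in>I. ennreal (2 * card I) * mean M (g i) R) < (\<Prod>i\<in>I. mean M (g i) Q)"
    and R: "R \<in> S"
  shows "emeasure M R \<le> 2 * emeasure M (R - \<Union>{Q\<in>S. Q \<subset> R})"
proof -
  define n where "n = ennreal (card I)"
  have n: "n \<noteq> 0" "n \<noteq> top" using I by (auto simp: n_def)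
  have n2: "ennreal (2 * card I) = 2 * n" by (simp add: n_def ennreal_mult)
  define C where "C i = {Q\<in>S. Q \<subset> R \<and> 2 * n * mean M (g i) R < mean M (g i) Q}" for i
  have C: "finite (C i)" "C i \<subseteq> S" for i using S(1) by (auto simp: C_def)
  have sets: "\<Union>(C i) \<in> sets M" for i using C Q(1) by (intro sets.finite_Union) auto
  have cover: "\<Union>{Q\<in>S. Q \<subset> R} \<subseteq> (\<Union>i\<in>I. \<Union>(C i))"
  proof
    fix x assume "x \<in> \<Union>{Q\<in>S. Q \<subset> R}"
    then obtain Q where Q: "Q \<in> S" "Q \<subset> R" "x \<in> Q" by blast
    have "\<exists>i\<in>I. 2 * n * mean M (g i) R < mean M (g i) Q"
    proof (rule ccontr)
      assume "\<not> ?thesis"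
      then have "(\<Prod>i\<in>I. mean M (g i) Q) \<le> (\<Prod>i\<in>I. ennreal (2 * card I) * mean M (g i) R)"
        unfolding n2 by (intro ennreal_prod_mono) (auto simp: not_less)
      then show False using grow[OF Q(1) R Q(2)] by simp
    qed
    then show "x \<in> (\<Union>i\<in>I. \<Union>(C i))" using Q by (auto simp: C_def)
  qed
  have part: "2 * n * emeasure M (\<Union>(C i)) \<le> emeasure M R" if i: "i \<in> I" for i
  proof -
    define t where "t = mean M (g i) R"
    have int: "t * emeasure M R = (\<integral>\<^sup>+x\<in>R. g i x \<partial>M)"
      unfolding t_def by (rule mean_times_emeasure[OF Q(2,3)[OF R]])
    have "2 * n * t * emeasure M (\<Union>(C i)) \<le> (\<integral>\<^sup>+x\<in>\<Union>(C i). g i x \<partial>M)"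
    proof (rule laminar_weak_type[OF C(1) laminar_subset[OF S(2) C(2)]])
      fix Q' assume "Q' \<in> C i"
      then have Q': "Q' \<in> S" "2 * n * t \<le> mean M (g i) Q'" by (auto simp: C_def t_def)
      then show "2 * n * t * emeasure M Q' \<le> (\<integral>\<^sup>+x\<in>Q'. g i x \<partial>M)"
        using mult_right_mono[OF Q'(2), of "emeasure M Q'"] mean_times_emeasure[OF Q(2,3)[OF Q'(1)], of "g i"] by simp
    qed (use C Q(1) i in auto)
    also have "\<dots> \<le> (\<integral>\<^sup>+x\<in>R. g i x \<partial>M)"
      by (intro nn_integral_mono) (auto simp: C_def indicator_def)
    finally have le: "t * (2 * n * emeasure M (\<Union>(C i))) \<le> t * emeasure M R"
      unfolding int by (simp add: mult_ac)
    consider "t = 0" | "t = top" | "t \<noteq> 0" "t \<noteq> top" by blast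
    then show ?thesis
    proof cases
      case 1
      have "Q' \<notin> C i" for Q'
      proof
        assume Q': "Q' \<in> C i"
        then have "(\<integral>\<^sup>+x\<in>Q'. g i x \<partial>M) \<le> (\<integral>\<^sup>+x\<in>R. g i x \<partial>M)"
          by (intro nn_integral_mono) (auto simp: C_def indicator_def)
        also have "\<dots> = 0" using int 1 by simp
        finally have "mean M (g i) Q' = 0" by (simp add: mean_def)
        then show False using Q' by (simp add: C_def)
      qed
      then have "C i = {}" by blast
      then show ?thesis by simp
    next
      case 2
      then have "2 * n * t = top" using n by (simp add: ennreal_mult_top)
      then have "C i = {}" unfolding C_def t_def by simp
      then show ?thesis by simp
    next
      case 3
      then show ?thesis using le by (simp add: ennreal_mult_le_mult_iff)
    qed
  qed
  define U where "U = \<Union>{Q\<in>S. Q \<subset> R}"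
  have U: "U \<in> sets M" "U \<subseteq> R" unfolding U_def using S(1) Q(1) by (auto intro!: sets.finite_Union)
  have "2 * n * emeasure M U \<le> 2 * n * (\<Sum>i\<in>I. emeasure M (\<Union>(C i)))"
  proof (intro mult_left_mono)
    have "emeasure M U \<le> emeasure M (\<Union>i\<in>I. \<Union>(C i))"
      unfolding U_def using cover I sets by (intro emeasure_mono sets.finite_UN) auto
    also have "\<dots> \<le> (\<Sum>i\<in>I. emeasure M (\<Union>(C i)))"
      using I sets by (intro emeasure_subadditive_finite) auto
    finally show "emeasure M U \<le> \<dots>" .
  qed auto
  also have "\<dots> \<le> (\<Sum>i\<in>I. emeasure M R)"
    unfolding sum_distrib_left by (intro sum_mono part)
  also have "\<dots> = n * emeasure M R" by (simp add: n_def ennreal_of_nat_eq_real_of_nat)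
  finally have "n * (2 * emeasure M U) \<le> n * emeasure M R" by (simp add: mult_ac)
  then have half: "2 * emeasure M U \<le> emeasure M R"
    using n by (simp add: ennreal_mult_le_mult_iff)
  have split: "emeasure M R = emeasure M (R - U) + emeasure M U"
    using U Q(1)[OF R] plus_emeasure[of "R - U" M U] by (simp add: Un_absorb2 Diff_disjoint Int_commute)
  have "emeasure M R + emeasure M R \<le> 2 * emeasure M (R - U) + emeasure M R"
  proof -
    have "emeasure M R + emeasure M R = 2 * emeasure M (R - U) + 2 * emeasure M U"
      by (subst (1 2) split) (simp add: mult_2 ac_simps)
    then show ?thesis using half by (simp add: add_left_mono)
  qed
  then have "emeasure M R \<le> 2 * emeasure M (R - U)"
    using Q(3)[OF R] by (auto simp: ennreal_add_left_cancel_le add.commute)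
  then show ?thesis by (simp add: U_def)
qed

section \<open>The two-weight estimate for a finite laminar family\<close>

definition two_weight_const :: "'b set \<Rightarrow> ('b \<Rightarrow> real) \<Rightarrow> real \<Rightarrow> real" where
  "two_weight_const I P p =
     ((2 * real (card I)) ^ card I) powr p * 8 * (\<Prod>i\<in>I. maximal_const (P i) powr (p / P i))"

text \<open>
The core of the proof. Write \<open>\<sigma>(Q)\<close> for the integral of \<open>\<sigma>\<close> over \<open>Q\<close>. Take the stopping family \<open>S\<close> for the
products of means of \<open>h\<^sub>i \<sigma>\<^sub>i\<close> with the ratio that makes it sparse. Factoring every mean of \<open>h\<^sub>i \<sigma>\<^sub>i\<close> into the
\<open>\<sigma>\<^sub>i\<close>-weighted mean of \<open>h\<^sub>i\<close> and the mean of \<open>\<sigma>\<^sub>i\<close>, and splitting the exponent of the latter by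
\<open>p = p / p\<^sub>i' + p / p\<^sub>i\<close>, the hypothesis \<open>A\<close> absorbs the weight \<open>v\<close> together with the powers \<open>p / p\<^sub>i'\<close>. What is
left is \<open>\<Sum>Q\<in>S. \<psi> Q * c Q * \<bar>Q\<bar>\<close>, where \<open>\<psi>\<close> is made of weighted means of the \<open>h\<^sub>i\<close> and \<open>c\<close> of the powers
\<open>p / p\<^sub>i\<close> of the means of the \<open>\<sigma>\<^sub>i\<close>.

Sparseness replaces \<open>\<bar>Q\<bar>\<close> by the measure of disjoint subsets, so that the hypothesis \<open>W\<close> says exactly that
the coefficients \<open>c Q * \<bar>Q\<bar>\<close> satisfy a Carleson condition for the measure \<open>\<mu> = (\<Prod>i. \<sigma>\<^sub>i powr (p / p\<^sub>i)) dx\<close>. The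
Carleson embedding, Hoelder's inequality with the exponents \<open>p\<^sub>i / p\<close> and the maximal theorem for each
measure \<open>\<sigma>\<^sub>i dx\<close> finish the proof. Only powers \<open>p\<close> of norms are added, so \<open>p < 1\<close> causes no difficulty.
\<close>

lemma laminar_two_weight:
  fixes I :: "'b set" and P :: "'b \<Rightarrow> real" and h \<sigma> :: "'b \<Rightarrow> 'a \<Rightarrow> ennreal" and v :: "'a \<Rightarrow> ennreal"
  assumes I: "finite I" "I \<noteq> {}" and P: "\<And>i. i \<in> I \<Longrightarrow> 1 < P i" and p: "0 < p" "(\<Sum>i\<in>I. p / P i) = 1"
    and F: "finite F" "laminar F"
    and Q: "\<And>Q. Q \<in> F \<Longrightarrow> Q \<in> sets M" "\<And>Q. Q \<in> F \<Longrightarrow> 0 < emeasure M Q" "\<And>Q. Q \<in> F \<Longrightarrow> emeasure M Q < top"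
    and v [measurable]: "v \<in> borel_measurable M"
    and h [measurable]: "\<And>i. i \<in> I \<Longrightarrow> h i \<in> borel_measurable M"
    and \<sigma> [measurable]: "\<And>i. i \<in> I \<Longrightarrow> \<sigma> i \<in> borel_measurable M"
    and \<sigma>Q: "\<And>i Q. i \<in> I \<Longrightarrow> Q \<in> F \<Longrightarrow> 0 < (\<integral>\<^sup>+x\<in>Q. \<sigma> i x \<partial>M)"
      "\<And>i Q. i \<in> I \<Longrightarrow> Q \<in> F \<Longrightarrow> (\<integral>\<^sup>+x\<in>Q. \<sigma> i x \<partial>M) < top"
    and A: "\<And>Q. Q \<in> F \<Longrightarrow> mean M v Q * (\<Prod>i\<in>I. epowr (mean M (\<sigma> i) Q) (p / conj_exp (P i))) \<le> A"
    and W: "\<And>R. R \<in> F \<Longrightarrow>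
      (\<integral>\<^sup>+x\<in>R. (SUP Q\<in>{Q\<in>F. x \<in> Q \<and> Q \<subseteq> R}. \<Prod>i\<in>I. epowr (mean M (\<sigma> i) Q) (p / P i)) \<partial>M)
      \<le> W * (\<integral>\<^sup>+x\<in>R. (\<Prod>i\<in>I. epowr (\<sigma> i x) (p / P i)) \<partial>M)"
  shows "(\<integral>\<^sup>+x. (SUP Q\<in>F. epowr (\<Prod>i\<in>I. mean M (\<lambda>x. h i x * \<sigma> i x) Q) p * indicator Q x) * v x \<partial>M)
     \<le> ennreal (two_weight_const I P p) * (A * W) *
        (\<Prod>i\<in>I. epowr (\<integral>\<^sup>+x. epowr (h i x) (P i) * \<sigma> i x \<partial>M) (p / P i))"
proof -
  define \<theta> where "\<theta> i = p / P i" for i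
  have \<theta>: "0 < \<theta> i" if "i \<in> I" for i using P[OF that] p by (simp add: \<theta>_def)
  define N where "N i = density M (\<sigma> i)" for i
  define u where "u Q = (\<Prod>i\<in>I. mean M (\<lambda>x. h i x * \<sigma> i x) Q)" for Q
  define \<psi> where "\<psi> Q = epowr (\<Prod>i\<in>I. mean (N i) (h i) Q) p" for Q
  define c where "c Q = (\<Prod>i\<in>I. epowr (mean M (\<sigma> i) Q) (\<theta> i))" for Q
  define s where "s x = (\<Prod>i\<in>I. epowr (\<sigma> i x) (\<theta> i))" for x
  define \<mu> where "\<mu> = density M s"
  define a where "a = (2 * real (card I)) ^ card I"
  have card: "1 \<le> real (card I)" using I by (simp add: Suc_le_eq card_gt_0_iff)
  have a: "1 \<le> a" unfolding a_def using card by (intro one_le_power) auto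
  have [measurable]: "s \<in> borel_measurable M" unfolding s_def by measurable
  have N_emeasure: "emeasure (N i) Q = (\<integral>\<^sup>+x\<in>Q. \<sigma> i x \<partial>M)" if "i \<in> I" "Q \<in> F" for i Q
    unfolding N_def using that Q(1) by (intro emeasure_density) auto
  have N_int: "(\<integral>\<^sup>+x. k x \<partial>N i) = (\<integral>\<^sup>+x. \<sigma> i x * k x \<partial>M)" if "i \<in> I" "k \<in> borel_measurable M" for i k
    unfolding N_def using that by (intro nn_integral_density) auto
  \<comment> \<open>The weighted mean of \<open>h i\<close> is a mean for the measure \<open>N i\<close> with density \<open>\<sigma> i\<close>.\<close>
  have factor: "mean M (\<lambda>x. h i x * \<sigma> i x) Q = mean (N i) (h i) Q * mean M (\<sigma> i) Q"
    if iQ: "i \<in> I" "Q \<in> F" for i Q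
  proof -
    have "mean (N i) (h i) Q * emeasure (N i) Q = (\<integral>\<^sup>+x\<in>Q. h i x \<partial>N i)"
      using \<sigma>Q[OF iQ] by (intro mean_times_emeasure) (auto simp: N_emeasure[OF iQ])
    also have "\<dots> = (\<integral>\<^sup>+x\<in>Q. (h i x * \<sigma> i x) \<partial>M)"
      using iQ Q(1) by (subst N_int) (auto simp: mult_ac intro!: borel_measurable_times_ennreal borel_measurable_indicator)
    finally show ?thesis
      unfolding N_emeasure[OF iQ] mean_def[of M] by (simp add: ennreal_times_divide)
  qed
  obtain S where S: "S \<subseteq> F"
    "\<And>Q. Q \<in> F \<Longrightarrow> \<exists>R\<in>S. Q \<subseteq> R \<and> u Q \<le> ennreal a * u R"
    "\<And>Q R. Q \<in> S \<Longrightarrow> R \<in> S \<Longrightarrow> Q \<subset> R \<Longrightarrow> ennreal a * u R < u Q"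
    using stopping_subfamily[OF F(1), of "ennreal a" u] a by auto
  have finS: "finite S" using S(1) F(1) finite_subset by blast
  have lamS: "laminar S" by (rule laminar_subset[OF F(2) S(1)])
  have QS: "\<And>Q. Q \<in> S \<Longrightarrow> Q \<in> sets M" "\<And>Q. Q \<in> S \<Longrightarrow> 0 < emeasure M Q" "\<And>Q. Q \<in> S \<Longrightarrow> emeasure M Q < top"
    using Q S(1) by auto
  \<comment> \<open>Linearization: the maximal function is controlled by a sum over the stopping family.\<close>
  have step1: "(SUP Q\<in>F. epowr (u Q) p * indicator Q x) \<le> ennreal (a powr p) * (\<Sum>R\<in>S. epowr (u R) p * indicator R x)" for x
  proof (rule SUP_least)
    fix Q assume "Q \<in> F"
    show "epowr (u Q) p * indicator Q x \<le> ennreal (a powr p) * (\<Sum>R\<in>S. epowr (u R) p * indicator R x)"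
    proof (cases "x \<in> Q")
      case True
      obtain R where R: "R \<in> S" "Q \<subseteq> R" "u Q \<le> ennreal a * u R" using S(2)[OF \<open>Q \<in> F\<close>] by auto
      have "epowr (u Q) p \<le> epowr (ennreal a * u R) p"
        using R(3) p by (intro epowr_mono) auto
      also have "\<dots> = ennreal (a powr p) * (epowr (u R) p * indicator R x)"
        using a True R(2) by (auto simp: epowr_mult epowr_ennreal indicator_def)
      also have "\<dots> \<le> ennreal (a powr p) * (\<Sum>R\<in>S. epowr (u R) p * indicator R x)"
        using R(1) finS by (intro mult_left_mono member_le_sum[where f = "\<lambda>R. epowr (u R) p * indicator R x"]) auto
      finally show ?thesis using True by simp
    qed simp
  qed
  \<comment> \<open>One application of the two-weight condition for each stopping set.\<close>
  have step2: "epowr (u R) p * (\<integral>\<^sup>+x\<in>R. v x \<partial>M) \<le> A * (\<psi> R * (c R * emeasure M R))" if "R \<in> S" for R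
  proof -
    have RF: "R \<in> F" using that S(1) by auto
    have exps: "p = p / conj_exp (P i) + \<theta> i" if "i \<in> I" for i
      using P[OF that] by (simp add: \<theta>_def conj_exp_def field_simps)
    have "epowr (u R) p = \<psi> R * (\<Prod>i\<in>I. epowr (mean M (\<sigma> i) R) p)"
      unfolding u_def \<psi>_def using RF by (simp add: factor epowr_prod epowr_mult prod.distrib cong: prod.cong)
    also have "(\<Prod>i\<in>I. epowr (mean M (\<sigma> i) R) p)
        = (\<Prod>i\<in>I. epowr (mean M (\<sigma> i) R) (p / conj_exp (P i))) * c R"
      unfolding c_def prod.distrib[symmetric] epowr_add[symmetric] using exps by (intro prod.cong) auto
    finally have "epowr (u R) p * (mean M v R * emeasure M R)
        = (mean M v R * (\<Prod>i\<in>I. epowr (mean M (\<sigma> i) R) (p / conj_exp (P i)))) * (\<psi> R * (c R * emeasure M R))"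
      by (simp add: mult_ac)
    also have "\<dots> \<le> A * (\<psi> R * (c R * emeasure M R))"
      by (intro mult_right_mono A RF) auto
    finally show ?thesis
      by (simp add: mean_times_emeasure[OF Q(2,3)[OF RF]])
  qed
  \<comment> \<open>The Carleson condition. The sets \<open>E Q\<close> consist of the points whose smallest stopping set is \<open>Q\<close>.\<close>
  have step3: "(\<Sum>Q | Q \<in> S \<and> Q \<subseteq> R. c Q * emeasure M Q) \<le> (2 * W) * emeasure \<mu> R" if R: "R \<in> S" for R
  proof -
    define E where "E Q = Q - \<Union>{Q'\<in>S. Q' \<subset> Q}" for Q
    have E [measurable]: "E Q \<in> sets M" if "Q \<in> S" for Q
      unfolding E_def using that QS(1) finS by (intro sets.Diff sets.finite_Union) auto
    have unique: "Q = Q'" if "Q \<in> S" "Q' \<in> S" "x \<in> E Q" "x \<in> E Q'" for Q Q' x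
      using laminarD[OF lamS that(1,2), of x] that unfolding E_def by blast
    have "(\<Sum>Q | Q \<in> S \<and> Q \<subseteq> R. c Q * emeasure M Q) \<le> (\<Sum>Q | Q \<in> S \<and> Q \<subseteq> R. c Q * (2 * emeasure M (E Q)))"
    proof (intro sum_mono mult_left_mono)
      fix Q assume "Q \<in> {Q. Q \<in> S \<and> Q \<subseteq> R}"
      then have QinS: "Q \<in> S" by simp
      show "emeasure M Q \<le> 2 * emeasure M (E Q)"
        unfolding E_def
      proof (rule sparse_of_growth[OF finS lamS QS I _ _ QinS])
        fix Q R assume *: "Q \<in> S" "R \<in> S" "Q \<subset> R"
        have "(\<Prod>i\<in>I. ennreal (2 * card I) * mean M (\<lambda>x. h i x * \<sigma> i x) R) = ennreal a * u R"
          by (simp add: prod.distrib u_def a_def ennreal_power)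
        then show "(\<Prod>i\<in>I. ennreal (2 * card I) * mean M (\<lambda>x. h i x * \<sigma> i x) R)
            < (\<Prod>i\<in>I. mean M (\<lambda>x. h i x * \<sigma> i x) Q)"
          using S(3)[OF *] by (simp add: u_def)
      qed auto
    qed auto
    also have "\<dots> = 2 * (\<integral>\<^sup>+x. (\<Sum>Q | Q \<in> S \<and> Q \<subseteq> R. c Q * indicator (E Q) x) \<partial>M)"
      using E by (subst nn_integral_sum) (auto simp: nn_integral_cmult_indicator sum_distrib_left mult_ac intro!: sum.cong)
    also have "\<dots> \<le> 2 * (\<integral>\<^sup>+x\<in>R. (SUP Q\<in>{Q\<in>F. x \<in> Q \<and> Q \<subseteq> R}. c Q) \<partial>M)"
    proof (intro mult_left_mono nn_integral_mono)
      fix x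
      show "(\<Sum>Q | Q \<in> S \<and> Q \<subseteq> R. c Q * indicator (E Q) x) \<le> (SUP Q\<in>{Q\<in>F. x \<in> Q \<and> Q \<subseteq> R}. c Q) * indicator R x"
      proof (cases "\<exists>Q\<in>S. Q \<subseteq> R \<and> x \<in> E Q")
        case True
        then obtain Q where Q': "Q \<in> S" "Q \<subseteq> R" "x \<in> E Q" by blast
        have xQ: "x \<in> Q" using Q'(3) by (simp add: E_def)
        have "(\<Sum>Q' | Q' \<in> S \<and> Q' \<subseteq> R. c Q' * indicator (E Q') x) = (\<Sum>Q' | Q' \<in> S \<and> Q' \<subseteq> R. if Q' = Q then c Q else 0)"
          using unique[OF _ Q'(1) _ Q'(3)] Q'(3) by (intro sum.cong) (auto simp: indicator_def)
        also have "\<dots> = c Q" using finS Q' by (subst sum.delta) auto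
        also have "\<dots> \<le> (SUP Q\<in>{Q\<in>F. x \<in> Q \<and> Q \<subseteq> R}. c Q)"
          using S(1) Q' xQ by (intro SUP_upper) auto
        finally show ?thesis using Q'(2) xQ by (auto simp: indicator_def)
      next
        case False
        then have "(\<Sum>Q | Q \<in> S \<and> Q \<subseteq> R. c Q * indicator (E Q) x) = 0"
          by (intro sum.neutral) (auto simp: indicator_def)
        then show ?thesis by simp
      qed
    qed auto
    also have "\<dots> \<le> 2 * (W * (\<integral>\<^sup>+x\<in>R. s x \<partial>M))"
      using W[of R] R S(1) unfolding c_def s_def \<theta>_def by (intro mult_left_mono) auto
    also have "(\<integral>\<^sup>+x\<in>R. s x \<partial>M) = emeasure \<mu> R"
      unfolding \<mu>_def using QS(1)[OF R] by (intro emeasure_density[symmetric]) auto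
    finally show ?thesis by (simp add: mult_ac)
  qed
  have step4: "(\<Sum>R\<in>S. \<psi> R * (c R * emeasure M R)) \<le> 4 * (2 * W) * (\<integral>\<^sup>+x. (SUP Q\<in>S. \<psi> Q * indicator Q x) \<partial>\<mu>)"
    using QS(1) by (intro carleson_embedding finS lamS step3) (auto simp: \<mu>_def)
  define G where "G i x = (SUP Q\<in>F. epowr (mean (N i) (h i) Q) (P i) * indicator Q x)" for i x
  have G [measurable]: "G i \<in> borel_measurable M" for i
    unfolding G_def using F(1) Q(1) by (intro borel_measurable_SUP countable_finite) auto
  \<comment> \<open>Hoelder: the \<open>\<psi>\<close>-maximal function is at most the product of the powers \<open>p\<close> of the weighted maximal functions.\<close>
  have step5: "(\<integral>\<^sup>+x. (SUP Q\<in>S. \<psi> Q * indicator Q x) \<partial>\<mu>) \<le> (\<Prod>i\<in>I. epowr (\<integral>\<^sup>+x. G i x \<partial>N i) (\<theta> i))"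
  proof -
    have "(\<integral>\<^sup>+x. (SUP Q\<in>S. \<psi> Q * indicator Q x) \<partial>\<mu>) = (\<integral>\<^sup>+x. s x * (SUP Q\<in>S. \<psi> Q * indicator Q x) \<partial>M)"
      unfolding \<mu>_def using finS QS(1)
      by (intro nn_integral_density borel_measurable_SUP countable_finite) auto
    also have "\<dots> \<le> (\<integral>\<^sup>+x. (\<Prod>i\<in>I. epowr (G i x * \<sigma> i x) (\<theta> i)) \<partial>M)"
    proof (rule nn_integral_mono)
      fix x
      have "(SUP Q\<in>S. \<psi> Q * indicator Q x) \<le> (\<Prod>i\<in>I. epowr (G i x) (\<theta> i))"
      proof (rule SUP_least)
        fix Q assume "Q \<in> S"
        show "\<psi> Q * indicator Q x \<le> (\<Prod>i\<in>I. epowr (G i x) (\<theta> i))"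
        proof (cases "x \<in> Q")
          case True
          have "\<psi> Q = (\<Prod>i\<in>I. epowr (epowr (mean (N i) (h i) Q) (P i)) (\<theta> i))"
            unfolding \<psi>_def epowr_prod using P by (intro prod.cong) (force simp: epowr_epowr \<theta>_def)+
          also have "\<dots> \<le> (\<Prod>i\<in>I. epowr (G i x) (\<theta> i))"
          proof (intro ennreal_prod_mono epowr_mono)
            fix i assume "i \<in> I"
            then show "0 \<le> \<theta> i" using \<theta>[of i] by simp
            show "epowr (mean (N i) (h i) Q) (P i) \<le> G i x"
              unfolding G_def using \<open>Q \<in> S\<close> S(1) True by (intro SUP_upper2[of Q]) auto
          qed
          finally show ?thesis using True by simp
        qed simp
      qed
      then have "s x * (SUP Q\<in>S. \<psi> Q * indicator Q x) \<le> s x * (\<Prod>i\<in>I. epowr (G i x) (\<theta> i))"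
        by (intro mult_left_mono) auto
      also have "\<dots> = (\<Prod>i\<in>I. epowr (G i x * \<sigma> i x) (\<theta> i))"
        by (simp add: s_def epowr_mult prod.distrib mult.commute)
      finally show "s x * (SUP Q\<in>S. \<psi> Q * indicator Q x) \<le> \<dots>" .
    qed
    also have "\<dots> \<le> (\<Prod>i\<in>I. epowr (\<integral>\<^sup>+x. G i x * \<sigma> i x \<partial>M) (\<theta> i))"
      using I(1) \<theta> p(2) by (intro Hoelder_product) (auto simp: \<theta>_def)
    also have "\<dots> = (\<Prod>i\<in>I. epowr (\<integral>\<^sup>+x. G i x \<partial>N i) (\<theta> i))"
      by (intro prod.cong) (auto simp: N_int mult.commute)
    finally show ?thesis .
  qed
  have step6: "(\<integral>\<^sup>+x. G i x \<partial>N i) \<le> ennreal (maximal_const (P i)) * (\<integral>\<^sup>+x. epowr (h i x) (P i) * \<sigma> i x \<partial>M)" if i: "i \<in> I" for i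
  proof -
    have "(\<integral>\<^sup>+x. G i x \<partial>N i) \<le> ennreal (maximal_const (P i)) * (\<integral>\<^sup>+x. epowr (h i x) (P i) \<partial>N i)"
      unfolding G_def using \<sigma>Q[OF i] N_emeasure[OF i] Q(1) h[OF i]
      by (intro laminar_maximal P i F) (auto simp: N_def)
    then show ?thesis using i by (simp add: N_int mult.commute)
  qed
  define J where "J i = (\<integral>\<^sup>+x. epowr (h i x) (P i) * \<sigma> i x \<partial>M)" for i
  have maxc: "0 \<le> maximal_const q" for q by (simp add: maximal_const_def)
  have "(\<integral>\<^sup>+x. (SUP Q\<in>F. epowr (u Q) p * indicator Q x) * v x \<partial>M)
      \<le> (\<integral>\<^sup>+x. ennreal (a powr p) * (\<Sum>R\<in>S. epowr (u R) p * indicator R x) * v x \<partial>M)"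
    by (intro nn_integral_mono mult_right_mono step1) auto
  also have "\<dots> = (\<integral>\<^sup>+x. ennreal (a powr p) * (\<Sum>R\<in>S. epowr (u R) p * (v x * indicator R x)) \<partial>M)"
    by (intro nn_integral_cong) (simp add: sum_distrib_left sum_distrib_right mult_ac)
  also have "\<dots> = ennreal (a powr p) * (\<Sum>R\<in>S. epowr (u R) p * (\<integral>\<^sup>+x\<in>R. v x \<partial>M))"
    using QS(1) by (simp add: nn_integral_cmult nn_integral_sum)
  also have "\<dots> \<le> ennreal (a powr p) * (\<Sum>R\<in>S. A * (\<psi> R * (c R * emeasure M R)))"
    by (intro mult_left_mono sum_mono step2) auto
  also have "\<dots> \<le> ennreal (a powr p) * (A * (4 * (2 * W) * (\<Prod>i\<in>I. epowr (ennreal (maximal_const (P i)) * J i) (\<theta> i))))"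
    unfolding sum_distrib_left[symmetric]
  proof (intro mult_left_mono order_trans[OF step4] order_trans[OF step5] ennreal_prod_mono epowr_mono)
    fix i assume "i \<in> I"
    then show "0 \<le> \<theta> i" using \<theta>[of i] by simp
    show "(\<integral>\<^sup>+x. G i x \<partial>N i) \<le> ennreal (maximal_const (P i)) * J i"
      using step6[OF \<open>i \<in> I\<close>] by (simp add: J_def)
  qed auto
  also have "(\<Prod>i\<in>I. epowr (ennreal (maximal_const (P i)) * J i) (\<theta> i))
      = ennreal (\<Prod>i\<in>I. maximal_const (P i) powr \<theta> i) * (\<Prod>i\<in>I. epowr (J i) (\<theta> i))"
    using maxc by (simp add: epowr_mult prod.distrib epowr_ennreal prod_ennreal)
  also have "ennreal (a powr p) * (A * (4 * (2 * W) * (ennreal (\<Prod>i\<in>I. maximal_const (P i) powr \<theta> i) * (\<Prod>i\<in>I. epowr (J i) (\<theta> i)))))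
      = ennreal (two_weight_const I P p) * (A * W) * (\<Prod>i\<in>I. epowr (J i) (\<theta> i))"
  proof -
    have "ennreal (two_weight_const I P p) = ennreal (a powr p) * 8 * ennreal (\<Prod>i\<in>I. maximal_const (P i) powr \<theta> i)"
      by (simp add: two_weight_const_def a_def \<theta>_def ennreal_mult prod_nonneg)
    moreover have "4 * (2 * W) = 8 * W" by (simp flip: mult.assoc)
    ultimately show ?thesis by (simp add: mult_ac)
  qed
  finally show ?thesis by (simp add: u_def J_def \<theta>_def)
qed

section \<open>Shifted dyadic grids\<close>

text \<open>
The grid with shift \<open>\<alpha>\<close> has at level \<open>k\<close> half-open cubes of side \<open>2 powi k\<close>, translated by one third of the
side in the coordinates of \<open>\<alpha>\<close>. The direction of the translation alternates with the level: passing from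
side \<open>L\<close> to \<open>2 * L\<close>, the shift changes from \<open>L / 3\<close> to \<open>- 2 * L / 3\<close>, which is the same modulo \<open>L\<close>, so that
the levels of one grid are nested.
\<close>

definition grid_sign :: "int \<Rightarrow> int" where
  "grid_sign k = (if even k then 1 else -1)"

text \<open>
A cell is described by the integer coordinates that its points share, so that the cells of one level are
the classes of an equivalence relation and form a partition by construction.
\<close>

definition grid_index :: "'n set \<Rightarrow> int \<Rightarrow> real ^ 'n \<Rightarrow> 'n \<Rightarrow> int" where
  "grid_index \<alpha> k x = (\<lambda>i. \<lfloor>x $ i / 2 powi k - of_int (grid_sign k * of_bool (i \<in> \<alpha>)) / 3\<rfloor>)"

definition grid :: "'n set \<Rightarrow> (real ^ 'n) set set" where
  "grid \<alpha> = {{x. grid_index \<alpha> k x = j} | k j. True}"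

lemma countable_grid: "countable (grid (\<alpha> :: 'n::finite set))"
proof -
  have "grid \<alpha> = range (\<lambda>(k, j :: 'n \<Rightarrow> int). {x. grid_index \<alpha> k x = j})"
    by (auto simp: grid_def)
  then show ?thesis by simp
qed

text \<open>
The coordinates at a level determine those at the next coarser level; this is the nestedness of the grid.
\<close>

lemma grid_index_step:
  "grid_index \<alpha> (k + 1) x i = (grid_index \<alpha> k x i + grid_sign k * of_bool (i \<in> \<alpha>)) div 2"
proof -
  define s where "s = grid_sign k * of_bool (i \<in> \<alpha>)"
  have s': "grid_sign (k + 1) * of_bool (i \<in> \<alpha>) = - s"
    by (simp add: grid_sign_def s_def)
  have "x $ i / 2 powi (k + 1) - of_int (- s) / 3
      = ((x $ i / 2 powi k - of_int s / 3) + of_int s) / of_int 2"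
    by (simp add: power_int_add field_simps)
  then have "grid_index \<alpha> (k + 1) x i = \<lfloor>((x $ i / 2 powi k - of_int s / 3) + of_int s) / of_int 2\<rfloor>"
    by (simp only: grid_index_def s')
  also have "\<dots> = (\<lfloor>x $ i / 2 powi k - of_int s / 3\<rfloor> + s) div 2"
    by (simp only: floor_add_int floor_divide_real_eq_div[of 2])
  finally show ?thesis by (simp add: grid_index_def s_def)
qed

lemma grid_index_coarsen:
  assumes "k \<le> l" "grid_index \<alpha> k x = grid_index \<alpha> k y"
  shows "grid_index \<alpha> l x = grid_index \<alpha> l y"
  using assms(1)
proof (induction l rule: int_ge_induct)
  case (step l)
  then show ?case by (simp add: fun_eq_iff grid_index_step)
qed (rule assms(2))

lemma laminar_grid: "laminar (grid \<alpha>)"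
  unfolding laminar_def
proof (intro ballI)
  fix Q R assume "Q \<in> grid \<alpha>" "R \<in> grid \<alpha>"
  then obtain k j l j' where Q: "Q = {x. grid_index \<alpha> k x = j}" and R: "R = {x. grid_index \<alpha> l x = j'}"
    by (auto simp: grid_def)
  have nest: "{x. grid_index \<alpha> k x = j} \<subseteq> {x. grid_index \<alpha> l x = j'}"
    if "k \<le> l" "grid_index \<alpha> k z = j" "grid_index \<alpha> l z = j'" for k l j j' z
    using grid_index_coarsen[OF that(1)] that(2,3) by (metis (mono_tags, lifting) Collect_mono)
  show "Q \<subseteq> R \<or> R \<subseteq> Q \<or> Q \<inter> R = {}"
  proof (cases "Q \<inter> R = {}")
    case False
    then obtain z where "grid_index \<alpha> k z = j" "grid_index \<alpha> l z = j'" by (auto simp: Q R)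
    then show ?thesis unfolding Q R using nest[of k l z j j'] nest[of l k z j' j] by linarith
  qed simp
qed

section \<open>Comparison of cells and cubes\<close>

lemma emeasure_cube:
  fixes a :: "real ^ 'n"
  assumes "0 < r"
  shows "emeasure lborel (cbox a (\<chi> i. a $ i + r)) = ennreal (r ^ CARD('n))"
proof -
  have "emeasure lborel (cbox a (\<chi> i. a $ i + r)) = ennreal (measure lborel (cbox a (\<chi> i. a $ i + r)))"
    using emeasure_lborel_cbox_finite by (intro emeasure_eq_ennreal_measure) (auto simp: less_top)
  also have "measure lborel (cbox a (\<chi> i. a $ i + r)) = r ^ CARD('n)"
    using assms by (subst content_cbox_cart) (auto simp: interval_ne_empty_cart less_imp_le)
  finally show ?thesis .
qed

lemma cubes_measure:
  assumes "Q \<in> cubes"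
  shows "Q \<in> sets lebesgue" "0 < emeasure lebesgue Q" "emeasure lebesgue Q < top" "compact Q"
  using assms by (auto simp: cubes_def emeasure_cube)

lemma grid_cell_between_boxes:
  fixes \<alpha> :: "'n::finite set"
  assumes "Q = {x. grid_index \<alpha> k x = j}"
  obtains a where "box a (\<chi> i. a $ i + 2 powi k) \<subseteq> Q" "Q \<subseteq> cbox a (\<chi> i. a $ i + 2 powi k)"
proof
  define a :: "real ^ 'n" where "a = (\<chi> i. 2 powi k * (of_int (j i) + of_int (grid_sign k * of_bool (i \<in> \<alpha>)) / 3))"
  have L: "(0::real) < 2 powi k" by simp
  have iff: "grid_index \<alpha> k x i = j i \<longleftrightarrow> a $ i \<le> x $ i \<and> x $ i < a $ i + 2 powi k" for x i
    using L by (simp add: grid_index_def a_def floor_eq_iff field_simps)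
  then show "box a (\<chi> i. a $ i + 2 powi k) \<subseteq> Q" "Q \<subseteq> cbox a (\<chi> i. a $ i + 2 powi k)"
    by (auto simp: assms fun_eq_iff mem_box_cart less_imp_le)
qed

text \<open>
The suprema over cubes run over closed cubes, whereas cells are half-open. Cells can nevertheless be used
in the weight constants, since a cell differs from its closure only by a null set.
\<close>

lemma grid_cell_closed_cube:
  assumes "Q \<in> grid \<alpha>"
  obtains Q' where "Q' \<in> cubes" "Q \<subseteq> Q'" "Q' - Q \<in> null_sets lebesgue"
proof -
  obtain k j where "Q = {x. grid_index \<alpha> k x = j}" using assms by (auto simp: grid_def)
  then obtain a where a: "box a (\<chi> i. a $ i + 2 powi k) \<subseteq> Q" "Q \<subseteq> cbox a (\<chi> i. a $ i + 2 powi k)"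
    by (rule grid_cell_between_boxes)
  show ?thesis
  proof
    show "cbox a (\<chi> i. a $ i + 2 powi k) \<in> cubes"
      unfolding cubes_def by (intro CollectI exI conjI) auto
    have "cbox a (\<chi> i. a $ i + 2 powi k) - Q \<subseteq> cbox a (\<chi> i. a $ i + 2 powi k) - box a (\<chi> i. a $ i + 2 powi k)"
      using a(1) by blast
    then show "cbox a (\<chi> i. a $ i + 2 powi k) - Q \<in> null_sets lebesgue"
      using negligible_frontier_interval negligible_subset negligible_iff_null_sets by metis
  qed (rule a(2))
qed

lemma conull_subset:
  assumes "Q \<subseteq> Q'" "Q' - Q \<in> null_sets lebesgue" "Q' \<in> sets lebesgue"
  shows "Q \<in> sets lebesgue" "emeasure lebesgue Q = emeasure lebesgue Q'"
    "(\<integral>\<^sup>+x\<in>Q. u x \<partial>lebesgue) = (\<integral>\<^sup>+x\<in>Q'. u x \<partial>lebesgue)"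
    "mean lebesgue u Q = mean lebesgue u Q'"
proof -
  have Q: "Q = Q' - (Q' - Q)" using assms(1) by blast
  show "Q \<in> sets lebesgue" by (subst Q) (use assms in auto)
  show e: "emeasure lebesgue Q = emeasure lebesgue Q'"
    by (subst Q) (rule emeasure_Diff_null_set[OF assms(2,3)])
  have "AE x in lebesgue. indicator Q x = (indicator Q' x :: ennreal)"
    by (rule AE_I'[OF assms(2)]) (use assms(1) in \<open>auto simp: indicator_def\<close>)
  then show i: "(\<integral>\<^sup>+x\<in>Q. u x \<partial>lebesgue) = (\<integral>\<^sup>+x\<in>Q'. u x \<partial>lebesgue)"
    by (intro nn_integral_cong_AE) auto
  show "mean lebesgue u Q = mean lebesgue u Q'" by (simp add: mean_def e i)
qed

text \<open>
A half-open interval of length at most one third cannot contain both an integer and a point of \<open>\<int> + s / 3\<close>, because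
such points are at least one third apart. So one of the two shifts does not cut the interval.
\<close>

lemma one_third_shift:
  fixes y \<delta> :: real
  assumes "\<bar>s\<bar> = 1" "0 < \<delta>" "\<delta> \<le> 1 / 3" "\<lfloor>y\<rfloor> \<noteq> \<lfloor>y + \<delta>\<rfloor>"
  shows "\<lfloor>y - of_int s / 3\<rfloor> = \<lfloor>y + \<delta> - of_int s / 3\<rfloor>"
proof (rule ccontr)
  assume ne: "\<not> ?thesis"
  define m m' where "m = \<lfloor>y + \<delta>\<rfloor>" and "m' = \<lfloor>y + \<delta> - of_int s / 3\<rfloor>"
  have "\<lfloor>y\<rfloor> < m" using assms(2,4) floor_mono[of y "y + \<delta>"] by (simp add: m_def)
  then have m: "y < of_int m" "of_int m \<le> y + \<delta>"
    by (simp_all add: floor_less_iff m_def)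
  have "\<lfloor>y - of_int s / 3\<rfloor> < m'"
    using assms(2) ne floor_mono[of "y - of_int s / 3" "y + \<delta> - of_int s / 3"] by (simp add: m'_def)
  then have m': "y < of_int m' + of_int s / 3" "of_int m' + of_int s / 3 \<le> y + \<delta>"
    unfolding m'_def floor_less_iff by linarith+
  have "\<bar>of_int (3 * (m - m') - s)\<bar> < (1::real)"
    using m m' assms(3) by simp
  then have "\<bar>3 * (m - m') - s\<bar> < 1" by linarith
  then have "3 * (m - m') = s" by linarith
  then show False using assms(1) by presburger
qed

text \<open>
Choose the level with \<open>3 * r \<le> 2 powi k < 6 * r\<close>, where \<open>r\<close> is the side of \<open>Q\<close>, and shift exactly the
coordinates in which the unshifted grid of that level cuts \<open>Q\<close>.
\<close>

lemma one_third_trick: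
  fixes Q :: "(real ^ 'n::finite) set"
  assumes "Q \<in> cubes"
  obtains \<alpha> R where "R \<in> grid \<alpha>" "Q \<subseteq> R" "emeasure lebesgue R \<le> 6 ^ CARD('n) * emeasure lebesgue Q"
proof -
  obtain a r where Q: "Q = cbox a (\<chi> i. a $ i + r)" and r: "0 < r" using assms by (auto simp: cubes_def)
  define k where "k = \<lceil>log 2 (3 * r)\<rceil>"
  define L where "L = (2::real) powi k"
  have L_powr: "L = 2 powr of_int k" by (simp add: L_def powr_real_of_int')
  have L: "0 < L" by (simp add: L_def)
  have "log 2 (3 * r) \<le> of_int k" "of_int k < log 2 (3 * r) + 1" unfolding k_def by linarith+
  moreover have "log 2 (6 * r) = log 2 (3 * r) + 1"
    using r log_mult[of 2 2 "3 * r"] by simp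
  ultimately have "log 2 (3 * r) \<le> of_int k" "of_int k < log 2 (6 * r)" by simp_all
  then have Lr: "3 * r \<le> L" "L < 6 * r"
    unfolding L_powr using r by (simp only: log_le_iff, simp only: less_log_iff)
  define \<alpha> where "\<alpha> = {i. \<lfloor>a $ i / L\<rfloor> \<noteq> \<lfloor>(a $ i + r) / L\<rfloor>}"
  define R where "R = {x. grid_index \<alpha> k x = grid_index \<alpha> k a}"
  have R: "R \<in> grid \<alpha>" unfolding R_def grid_def by blast
  have "Q \<subseteq> R"
  proof
    fix x assume "x \<in> Q"
    then have x: "a $ i \<le> x $ i" "x $ i \<le> a $ i + r" for i by (auto simp: Q mem_box_cart)
    have "grid_index \<alpha> k x i = grid_index \<alpha> k a i" for i
    proof -
      define t where "t = (of_int (grid_sign k * of_bool (i \<in> \<alpha>)) / 3 :: real)"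
      have "\<lfloor>a $ i / L - t\<rfloor> = \<lfloor>a $ i / L + r / L - t\<rfloor>"
      proof (cases "i \<in> \<alpha>")
        case True
        then have "\<lfloor>a $ i / L\<rfloor> \<noteq> \<lfloor>a $ i / L + r / L\<rfloor>" by (simp add: \<alpha>_def add_divide_distrib)
        then have "\<lfloor>a $ i / L - of_int (grid_sign k) / 3\<rfloor> = \<lfloor>a $ i / L + r / L - of_int (grid_sign k) / 3\<rfloor>"
          using r L Lr by (intro one_third_shift) (auto simp: grid_sign_def field_simps)
        then show ?thesis using True by (simp add: t_def)
      next
        case False
        then show ?thesis by (simp add: \<alpha>_def add_divide_distrib t_def)
      qed
      moreover have "a $ i / L - t \<le> x $ i / L - t" "x $ i / L - t \<le> a $ i / L + r / L - t"
        using x[of i] L by (simp_all add: divide_right_mono flip: add_divide_distrib)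
      ultimately have "\<lfloor>x $ i / L - t\<rfloor> = \<lfloor>a $ i / L - t\<rfloor>"
        using floor_mono by (metis order_antisym)
      then show ?thesis by (simp add: grid_index_def t_def L_def)
    qed
    then show "x \<in> R" by (auto simp: R_def)
  qed
  moreover have "emeasure lebesgue R \<le> 6 ^ CARD('n) * emeasure lebesgue Q"
  proof -
    obtain b where b: "R \<subseteq> cbox b (\<chi> i. b $ i + L)"
      using grid_cell_between_boxes[OF R_def] unfolding L_def by metis
    have "emeasure lebesgue R \<le> emeasure lborel (cbox b (\<chi> i. b $ i + L))"
      using emeasure_mono[OF b, of lebesgue] by simp
    also have "\<dots> \<le> ennreal ((6 * r) ^ CARD('n))"
      using L Lr by (simp only: emeasure_cube) (intro ennreal_leI power_mono; simp)
    also have "\<dots> = 6 ^ CARD('n) * emeasure lebesgue Q"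
      using r by (simp add: Q emeasure_cube power_mult_distrib ennreal_mult flip: ennreal_power)
    finally show ?thesis .
  qed
  ultimately show ?thesis using R that by blast
qed

section \<open>Weights\<close>

lemma locally_integrable_measurable:
  assumes "locally_integrable w"
  shows "w \<in> borel_measurable lebesgue"
proof (rule borel_measurable_LIMSEQ_real)
  fix n
  have "w absolutely_integrable_on cball 0 (real n)"
    using assms by (simp add: locally_integrable_def)
  then show "(\<lambda>x. indicator (cball 0 (real n)) x *\<^sub>R w x) \<in> borel_measurable lebesgue"
    unfolding set_integrable_def by (rule borel_measurable_integrable)
next
  fix x :: "real ^ 'a"
  have "eventually (\<lambda>n. norm x \<le> real n) sequentially"
    using real_arch_simple[of "norm x"] eventually_at_top_linorder
    by (meson eventually_sequentiallyI of_nat_le_iff order_trans)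
  then have "eventually (\<lambda>n. indicator (cball 0 (real n)) x *\<^sub>R w x = w x) sequentially"
    by eventually_elim simp
  then show "(\<lambda>n. indicator (cball 0 (real n)) x *\<^sub>R w x) \<longlonglongrightarrow> w x"
    by (rule tendsto_eventually)
qed

lemma locally_integrable_finite:
  assumes "locally_integrable w" "compact K"
  shows "(\<integral>\<^sup>+x\<in>K. ennreal \<bar>w x\<bar> \<partial>lebesgue) < top"
proof -
  have "integrable lebesgue (\<lambda>x. indicator K x *\<^sub>R w x)"
    using assms by (simp add: locally_integrable_def set_integrable_def)
  then have "(\<integral>\<^sup>+x. ennreal (norm (indicator K x *\<^sub>R w x)) \<partial>lebesgue) < top"
    by (simp add: integrable_iff_bounded)
  also have "(\<lambda>x. ennreal (norm (indicator K x *\<^sub>R w x))) = (\<lambda>x. ennreal \<bar>w x\<bar> * indicator K x)"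
    by (auto simp: indicator_def)
  finally show ?thesis .
qed

lemma mean_eq_avg: "mean lebesgue (\<lambda>x. ennreal \<bar>g x\<bar>) Q = avg Q g"
  by (simp add: mean_def avg_def)

lemma mean_le_of_superset:
  assumes "Q \<subseteq> R" "0 < emeasure M Q" "0 < emeasure M R" "emeasure M R < top" "emeasure M R \<le> \<kappa> * emeasure M Q"
  shows "mean M u Q \<le> \<kappa> * mean M u R"
proof -
  have "(\<integral>\<^sup>+x\<in>Q. u x \<partial>M) \<le> (\<integral>\<^sup>+x\<in>R. u x \<partial>M)"
    using assms(1) by (intro nn_integral_mono) (auto simp: indicator_def)
  also have "\<dots> = mean M u R * emeasure M R"
    using mean_times_emeasure[OF assms(3,4)] by simp
  also have "\<dots> \<le> mean M u R * (\<kappa> * emeasure M Q)"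
    by (intro mult_left_mono assms) auto
  finally show ?thesis
    unfolding mean_def[of M u Q] using assms(2) by (intro divide_le_posI_ennreal) (auto simp: mult_ac)
qed

lemma nn_integral_positive:
  assumes "Q \<in> sets M" "0 < emeasure M Q" "u \<in> borel_measurable M" "AE x in M. 0 < u x"
  shows "0 < (\<integral>\<^sup>+x\<in>Q. u x \<partial>M)"
proof (rule ccontr)
  assume "\<not> ?thesis"
  then have "AE x in M. u x * indicator Q x = 0"
    using assms by (subst nn_integral_0_iff_AE[symmetric]) auto
  then have "AE x in M. x \<notin> Q"
    using assms(4) by eventually_elim (auto simp: indicator_def split: if_splits)
  then have "emeasure M Q = 0"
    using assms(1) sets.sets_into_space[OF assms(1)]
    by (subst (asm) AE_iff_measurable[of Q]) auto
  then show False using assms(2) by simp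
qed

section \<open>Passage from finite families to all cubes\<close>

text \<open>
Monotone convergence along an enumeration of the countable family.
\<close>

lemma countable_SUP_integral_le:
  fixes t :: "'b \<Rightarrow> 'a \<Rightarrow> ennreal"
  assumes "countable D" and [measurable]: "\<And>Q. Q \<in> D \<Longrightarrow> t Q \<in> borel_measurable M" "v \<in> borel_measurable M"
    and le: "\<And>F. finite F \<Longrightarrow> F \<subseteq> D \<Longrightarrow> (\<integral>\<^sup>+x. (SUP Q\<in>F. t Q x) * v x \<partial>M) \<le> C"
  shows "(\<integral>\<^sup>+x. (SUP Q\<in>D. t Q x) * v x \<partial>M) \<le> C"
proof (cases "D = {}")
  case True
  then show ?thesis by (simp add: bot_ennreal)
next
  case False
  define F where "F n = from_nat_into D ` {..n}" for n :: nat
  have F: "finite (F n)" "F n \<subseteq> D" "countable (F n)" for n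
    using from_nat_into[OF False] by (auto simp: F_def)
  have "(\<Union>n. F n) = range (from_nat_into D)" by (auto simp: F_def)
  then have UF: "(\<Union>n. F n) = D"
    using range_from_nat_into[OF False assms(1)] by simp
  have [measurable]: "(\<lambda>x. SUP Q\<in>F n. t Q x) \<in> borel_measurable M" for n
    using F(2)[of n] by (intro borel_measurable_SUP F(3) assms(2)) auto
  have "(SUP Q\<in>D. t Q x) * v x = (SUP n. (SUP Q\<in>F n. t Q x) * v x)" for x
    by (simp add: SUP_mult_right_ennreal[symmetric] SUP_UNION[symmetric] UF)
  then have "(\<integral>\<^sup>+x. (SUP Q\<in>D. t Q x) * v x \<partial>M) = (\<integral>\<^sup>+x. (SUP n. (SUP Q\<in>F n. t Q x) * v x) \<partial>M)"
    by simp
  also have "\<dots> = (SUP n. \<integral>\<^sup>+x. (SUP Q\<in>F n. t Q x) * v x \<partial>M)"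
  proof (rule nn_integral_monotone_convergence_SUP)
    show "incseq (\<lambda>n x. (SUP Q\<in>F n. t Q x) * v x)"
      by (auto simp: incseq_def le_fun_def F_def intro!: mult_right_mono SUP_subset_mono)
  qed measurable
  also have "\<dots> \<le> C" by (intro SUP_least le F)
  finally show ?thesis .
qed

text \<open>
The quotient in the definition of \<^const>\<open>W_const\<close> can be multiplied out because its denominator is positive
(the \<open>\<sigma> i\<close> are positive almost everywhere) and finite (by the arithmetic-geometric mean inequality it is at
most a convex combination of the finite integrals of the \<open>\<sigma> i\<close>).
\<close>

lemma W_const_bound:
  fixes \<sigma> :: "nat \<Rightarrow> real ^ 'n::finite \<Rightarrow> real"
  assumes \<theta>: "\<And>i. i \<in> {1..m} \<Longrightarrow> 0 < p / P i" "(\<Sum>i=1..m. p / P i) = 1"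
    and \<sigma>: "\<And>i. i \<in> {1..m} \<Longrightarrow> weight (\<sigma> i)" "\<And>i x. i \<in> {1..m} \<Longrightarrow> 0 \<le> \<sigma> i x"
    and R: "R \<in> cubes"
  shows "(\<integral>\<^sup>+x\<in>R. (\<Prod>i=1..m. epowr (HL_maximal (\<lambda>y. \<sigma> i y * indicator R y) x) (p / P i)) \<partial>lebesgue)
    \<le> W_const m P p \<sigma> * (\<integral>\<^sup>+x\<in>R. (\<Prod>i=1..m. epowr (ennreal (\<sigma> i x)) (p / P i)) \<partial>lebesgue)" (is "?X \<le> _ * ?Y")
proof -
  have meas [measurable]: "\<sigma> i \<in> borel_measurable lebesgue" if "i \<in> {1..m}" for i
    using \<sigma>(1)[OF that] locally_integrable_measurable by (auto simp: weight_def)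
  have Y: "?Y = (\<integral>\<^sup>+x\<in>R. ennreal (\<Prod>i=1..m. \<sigma> i x powr (p / P i)) \<partial>lebesgue)"
  proof -
    have "(\<Prod>i=1..m. epowr (ennreal (\<sigma> i x)) (p / P i)) = ennreal (\<Prod>i=1..m. \<sigma> i x powr (p / P i))" for x
      using \<sigma>(2) by (subst prod_ennreal[symmetric]) (auto simp: epowr_ennreal intro!: prod.cong)
    then show ?thesis by simp
  qed
  have "AE x in lebesgue. \<forall>i\<in>{1..m}. 0 < \<sigma> i x"
    using \<sigma>(1) by (intro AE_finite_allI) (auto simp: weight_def)
  then have "AE x in lebesgue. 0 < (\<Prod>i=1..m. epowr (ennreal (\<sigma> i x)) (p / P i))"
    by eventually_elim (auto simp: zero_less_iff_neq_zero)
  then have Ypos: "0 < ?Y"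
    using cubes_measure[OF R] by (intro nn_integral_positive) auto
  have "?Y \<le> (\<integral>\<^sup>+x. (\<Sum>i=1..m. ennreal (p / P i) * (ennreal \<bar>\<sigma> i x\<bar> * indicator R x)) \<partial>lebesgue)"
  proof (rule nn_integral_mono)
    fix x
    have "(\<Prod>i=1..m. epowr (ennreal (\<sigma> i x)) (p / P i)) \<le> (\<Sum>i=1..m. ennreal (p / P i) * ennreal (\<sigma> i x))"
      using \<theta> by (intro ennreal_AM_GM) auto
    also have "\<dots> = (\<Sum>i=1..m. ennreal (p / P i) * ennreal \<bar>\<sigma> i x\<bar>)"
      using \<sigma>(2) by (intro sum.cong) auto
    finally show "(\<Prod>i=1..m. epowr (ennreal (\<sigma> i x)) (p / P i)) * indicator R x
        \<le> (\<Sum>i=1..m. ennreal (p / P i) * (ennreal \<bar>\<sigma> i x\<bar> * indicator R x))"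
      by (auto simp: indicator_def)
  qed
  also have "\<dots> = (\<Sum>i=1..m. ennreal (p / P i) * (\<integral>\<^sup>+x\<in>R. ennreal \<bar>\<sigma> i x\<bar> \<partial>lebesgue))"
  proof -
    have "(\<lambda>x. ennreal \<bar>\<sigma> i x\<bar> * indicator R x) \<in> borel_measurable lebesgue" if "i \<in> {1..m}" for i
      using meas[OF that] cubes_measure(1)[OF R] by auto
    then show ?thesis
      by (subst nn_integral_sum) (auto intro!: sum.cong nn_integral_cmult)
  qed
  also have "\<dots> < top"
    using \<sigma>(1) locally_integrable_finite[OF _ cubes_measure(4)[OF R]]
    by (auto simp: weight_def ennreal_mult_less_top)
  finally have Yfin: "?Y < top" .
  have "?X * inverse ?Y \<le> W_const m P p \<sigma>"
    unfolding W_const_def Y using R by (intro SUP_upper2[of R]) auto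
  then have "?X * inverse ?Y * ?Y \<le> W_const m P p \<sigma> * ?Y" by (rule mult_right_mono) simp
  also have "?X * inverse ?Y * ?Y = ?X"
  proof -
    have "inverse ?Y * ?Y = 1"
      using Ypos Yfin ennreal_divide_self[of ?Y] by (simp add: divide_ennreal_def mult.commute)
    then show ?thesis by (simp add: mult.assoc)
  qed
  finally show ?thesis .
qed

text \<open>
For cells of one grid the hypotheses \<open>A\<close> and \<open>W\<close> of the laminar estimate follow from the two weight
constants after replacing each cell by its closure; for \<open>W\<close>, a cell \<open>Q \<subseteq> R\<close> contributes the mean of \<open>\<sigma> i\<close>
over a cube containing \<open>x\<close>, computed with \<open>\<sigma> i\<close> cut off outside the closure of \<open>R\<close>.
\<close>

lemma grid_two_weight:
  fixes v :: "real ^ 'n::finite \<Rightarrow> real" and w \<sigma> f :: "nat \<Rightarrow> real ^ 'n \<Rightarrow> real"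
  assumes m: "1 \<le> m" and P: "\<And>i. i \<in> {1..m} \<Longrightarrow> 1 < P i" and p: "0 < p" "(\<Sum>i=1..m. p / P i) = 1"
    and v: "weight v"
    and \<sigma>: "\<And>i. i \<in> {1..m} \<Longrightarrow> \<sigma> i = dual_weight (P i) (w i)" "\<And>i. i \<in> {1..m} \<Longrightarrow> weight (\<sigma> i)"
    and f: "\<And>i. i \<in> {1..m} \<Longrightarrow> f i \<in> borel_measurable lebesgue"
  shows "(\<integral>\<^sup>+x. (SUP Q\<in>grid \<alpha>. epowr (\<Prod>i=1..m. mean lebesgue (\<lambda>x. ennreal \<bar>f i x * \<sigma> i x\<bar>) Q) p * indicator Q x)
        * ennreal \<bar>v x\<bar> \<partial>lebesgue)
    \<le> ennreal (two_weight_const {1..m} P p) * (A_const m P p v w * W_const m P p \<sigma>) *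
        (\<Prod>i=1..m. epowr (\<integral>\<^sup>+x. epowr (ennreal \<bar>f i x\<bar>) (P i) * ennreal (\<sigma> i x) \<partial>lebesgue) (p / P i))"
proof (rule countable_SUP_integral_le[OF countable_grid])
  have \<sigma>0: "0 \<le> \<sigma> i x" if "i \<in> {1..m}" for i x using \<sigma>(1)[OF that] by (simp add: dual_weight_def)
  have abs\<sigma>: "\<bar>\<sigma> i x\<bar> = \<sigma> i x" if "i \<in> {1..m}" for i x using \<sigma>0[OF that] by simp
  have vm [measurable]: "v \<in> borel_measurable lebesgue"
    using v locally_integrable_measurable by (auto simp: weight_def)
  have \<sigma>m [measurable]: "\<sigma> i \<in> borel_measurable lebesgue" if "i \<in> {1..m}" for i
    using \<sigma>(2)[OF that] locally_integrable_measurable by (auto simp: weight_def)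
  have closure: "\<exists>Q'\<in>cubes. Q \<subseteq> Q' \<and> Q' - Q \<in> null_sets lebesgue" if "Q \<in> grid \<alpha>" for Q
    using grid_cell_closed_cube[OF that] by metis
  have Q: "Q \<in> sets lebesgue" "0 < emeasure lebesgue Q" "emeasure lebesgue Q < top" if "Q \<in> grid \<alpha>" for Q
    using closure[OF that] cubes_measure conull_subset(1,2) by metis+
  show "(\<lambda>x. ennreal \<bar>v x\<bar>) \<in> borel_measurable lebesgue" by measurable
  show "(\<lambda>x. epowr (\<Prod>i=1..m. mean lebesgue (\<lambda>x. ennreal \<bar>f i x * \<sigma> i x\<bar>) Q) p * indicator Q x) \<in> borel_measurable lebesgue"
    if "Q \<in> grid \<alpha>" for Q
    using Q(1)[OF that] by auto
  fix F assume F: "finite F" "F \<subseteq> grid \<alpha>"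
  have F_cube: "\<exists>Q'\<in>cubes. Q \<subseteq> Q' \<and> Q' - Q \<in> null_sets lebesgue" if "Q \<in> F" for Q
    using closure that F(2) by blast
  have "(\<integral>\<^sup>+x. (SUP Q\<in>F. epowr (\<Prod>i=1..m. mean lebesgue (\<lambda>x. ennreal \<bar>f i x\<bar> * ennreal (\<sigma> i x)) Q) p * indicator Q x)
        * ennreal \<bar>v x\<bar> \<partial>lebesgue)
    \<le> ennreal (two_weight_const {1..m} P p) * (A_const m P p v w * W_const m P p \<sigma>) *
        (\<Prod>i=1..m. epowr (\<integral>\<^sup>+x. epowr (ennreal \<bar>f i x\<bar>) (P i) * ennreal (\<sigma> i x) \<partial>lebesgue) (p / P i))"
  proof (rule laminar_two_weight[OF _ _ P p F(1) laminar_subset[OF laminar_grid F(2)]])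
    fix Q assume QF: "Q \<in> F"
    then have Qg: "Q \<in> grid \<alpha>" using F(2) by blast
    obtain Q' where Q': "Q' \<in> cubes" "Q \<subseteq> Q'" "Q' - Q \<in> null_sets lebesgue" using closure[OF Qg] by blast
    note cs = conull_subset[OF Q'(2,3) cubes_measure(1)[OF Q'(1)]]
    show "Q \<in> sets lebesgue" "0 < emeasure lebesgue Q" "emeasure lebesgue Q < top" using Q[OF Qg] by auto
    show "0 < (\<integral>\<^sup>+x\<in>Q. ennreal (\<sigma> i x) \<partial>lebesgue)" if "i \<in> {1..m}" for i
      using \<sigma>(2)[OF that] Q(1,2)[OF Qg] \<sigma>m[OF that] by (intro nn_integral_positive) (auto simp: weight_def)
    show "(\<integral>\<^sup>+x\<in>Q. ennreal (\<sigma> i x) \<partial>lebesgue) < top" if "i \<in> {1..m}" for i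
      using locally_integrable_finite[OF _ cubes_measure(4)[OF Q'(1)], of "\<sigma> i"] \<sigma>(2)[OF that]
      by (simp add: cs(3) abs\<sigma>[OF that] weight_def)
    have "mean lebesgue (\<lambda>x. ennreal \<bar>v x\<bar>) Q * (\<Prod>i=1..m. epowr (mean lebesgue (\<lambda>x. ennreal (\<sigma> i x)) Q) (p / conj_exp (P i)))
        = avg Q' v * (\<Prod>i=1..m. epowr (avg Q' (dual_weight (P i) (w i))) (p / conj_exp (P i)))"
      unfolding cs(4) mean_eq_avg[symmetric]
      by (intro arg_cong2[where f = "(*)"] prod.cong refl) (simp add: abs\<sigma> flip: \<sigma>(1))
    also have "\<dots> \<le> A_const m P p v w"
      unfolding A_const_def using Q'(1) by (intro SUP_upper2[of Q']) auto
    finally show "mean lebesgue (\<lambda>x. ennreal \<bar>v x\<bar>) Q * (\<Prod>i=1..m. epowr (mean lebesgue (\<lambda>x. ennreal (\<sigma> i x)) Q) (p / conj_exp (P i)))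
        \<le> A_const m P p v w" .
  next
    fix R assume RF: "R \<in> F"
    then obtain R' where R': "R' \<in> cubes" "R \<subseteq> R'" "R' - R \<in> null_sets lebesgue" using F_cube by blast
    note cs = conull_subset[OF R'(2,3) cubes_measure(1)[OF R'(1)]]
    have "(\<integral>\<^sup>+x\<in>R. (SUP Q\<in>{Q \<in> F. x \<in> Q \<and> Q \<subseteq> R}. \<Prod>i=1..m. epowr (mean lebesgue (\<lambda>x. ennreal (\<sigma> i x)) Q) (p / P i)) \<partial>lebesgue)
        \<le> (\<integral>\<^sup>+x\<in>R. (\<Prod>i=1..m. epowr (HL_maximal (\<lambda>y. \<sigma> i y * indicator R' y) x) (p / P i)) \<partial>lebesgue)"
    proof (intro nn_integral_mono mult_right_mono SUP_least ennreal_prod_mono epowr_mono)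
      fix x Q i assume "Q \<in> {Q \<in> F. x \<in> Q \<and> Q \<subseteq> R}" and i: "i \<in> {1..m}"
      then have QF: "Q \<in> F" "x \<in> Q" "Q \<subseteq> R" by auto
      show "0 \<le> p / P i" using P[OF i] p(1) by simp
      obtain Q' where Q': "Q' \<in> cubes" "Q \<subseteq> Q'" "Q' - Q \<in> null_sets lebesgue" using F_cube[OF QF(1)] by blast
      have "mean lebesgue (\<lambda>x. ennreal (\<sigma> i x)) Q = mean lebesgue (\<lambda>x. ennreal \<bar>\<sigma> i x * indicator R' x\<bar>) Q"
        unfolding mean_def using QF(3) R'(2) abs\<sigma>[OF i]
        by (intro arg_cong2[where f = "(/)"] nn_integral_cong) (auto simp: indicator_def abs_mult)
      also have "\<dots> = avg Q' (\<lambda>y. \<sigma> i y * indicator R' y)"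
        by (rule trans[OF conull_subset(4)[OF Q'(2,3) cubes_measure(1)[OF Q'(1)]] mean_eq_avg])
      also have "\<dots> \<le> HL_maximal (\<lambda>y. \<sigma> i y * indicator R' y) x"
        unfolding HL_maximal_def using Q'(1,2) QF(2) by (intro SUP_upper) auto
      finally show "mean lebesgue (\<lambda>x. ennreal (\<sigma> i x)) Q \<le> \<dots>" .
    qed auto
    also have "\<dots> \<le> W_const m P p \<sigma> * (\<integral>\<^sup>+x\<in>R. (\<Prod>i=1..m. epowr (ennreal (\<sigma> i x)) (p / P i)) \<partial>lebesgue)"
      unfolding cs(3) using P p \<sigma>(2) \<sigma>0 R'(1) by (intro W_const_bound) (auto intro!: divide_pos_pos intro: less_trans[OF zero_less_one])
    finally show "(\<integral>\<^sup>+x\<in>R. (SUP Q\<in>{Q \<in> F. x \<in> Q \<and> Q \<subseteq> R}. \<Prod>i=1..m. epowr (mean lebesgue (\<lambda>x. ennreal (\<sigma> i x)) Q) (p / P i)) \<partial>lebesgue) \<le> \<dots>" .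
  next
    show "(\<lambda>x. ennreal (\<sigma> i x)) \<in> borel_measurable lebesgue" "(\<lambda>x. ennreal \<bar>f i x\<bar>) \<in> borel_measurable lebesgue"
      if "i \<in> {1..m}" for i using \<sigma>m[OF that] f[OF that] by auto
  qed (use m in auto)
  also have "(\<lambda>Q. \<Prod>i=1..m. mean lebesgue (\<lambda>x. ennreal \<bar>f i x\<bar> * ennreal (\<sigma> i x)) Q)
      = (\<lambda>Q. \<Prod>i=1..m. mean lebesgue (\<lambda>x. ennreal \<bar>f i x * \<sigma> i x\<bar>) Q)"
    by (intro ext prod.cong refl) (simp add: abs_mult ennreal_mult abs\<sigma> \<sigma>0)
  finally show "(\<integral>\<^sup>+x. (SUP Q\<in>F. epowr (\<Prod>i=1..m. mean lebesgue (\<lambda>x. ennreal \<bar>f i x * \<sigma> i x\<bar>) Q) p * indicator Q x) * ennreal \<bar>v x\<bar> \<partial>lebesgue)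
    \<le> ennreal (two_weight_const {1..m} P p) * (A_const m P p v w * W_const m P p \<sigma>) *
        (\<Prod>i=1..m. epowr (\<integral>\<^sup>+x. epowr (ennreal \<bar>f i x\<bar>) (P i) * ennreal (\<sigma> i x) \<partial>lebesgue) (p / P i))" .
qed

text \<open>
By the one-third trick each cube lies in a cell of one of the \<open>2\<^sup>n\<close> grids of at most \<open>6\<^sup>n\<close> times its measure,
which costs this factor in each of the \<open>m\<close> means.
\<close>

lemma multi_maximal_le_grids:
  fixes g :: "nat \<Rightarrow> real ^ 'n::finite \<Rightarrow> real" and p :: real
  assumes p: "0 < p"
  shows "epowr (multi_maximal m g x) p \<le> ennreal ((6 ^ (CARD('n) * m)) powr p) *
     (\<Sum>\<alpha>\<in>(UNIV :: 'n set set). SUP Q\<in>grid \<alpha>. epowr (\<Prod>i=1..m. mean lebesgue (\<lambda>x. ennreal \<bar>g i x\<bar>) Q) p * indicator Q x)"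
    (is "_ \<le> ?K * (\<Sum>\<alpha>\<in>_. ?S \<alpha>)")
proof -
  \<comment> \<open>The power \<open>p\<close> is moved past the supremum by bounding each product by the power \<open>1 / p\<close> of the right-hand side.\<close>
  define B where "B = ?K * (\<Sum>\<alpha>\<in>UNIV. ?S \<alpha>)"
  have "multi_maximal m g x \<le> epowr B (1 / p)"
    unfolding multi_maximal_def
  proof (rule SUP_least)
    fix Q assume "Q \<in> {Q \<in> cubes. x \<in> Q}"
    then have Q: "Q \<in> cubes" "x \<in> Q" by auto
    obtain \<alpha> R where R: "R \<in> grid \<alpha>" "Q \<subseteq> R" "emeasure lebesgue R \<le> 6 ^ CARD('n) * emeasure lebesgue Q"
      by (rule one_third_trick[OF Q(1)])
    have posfin: "0 < emeasure lebesgue R" "emeasure lebesgue R < top"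
      using grid_cell_closed_cube[OF R(1)] conull_subset(2) cubes_measure by metis+
    have "avg Q (g i) \<le> 6 ^ CARD('n) * mean lebesgue (\<lambda>x. ennreal \<bar>g i x\<bar>) R" for i
      unfolding mean_eq_avg[symmetric] using R(2,3) cubes_measure[OF Q(1)] posfin
      by (intro mean_le_of_superset) auto
    then have "(\<Prod>i=1..m. avg Q (g i)) \<le> (\<Prod>i=1..m. 6 ^ CARD('n) * mean lebesgue (\<lambda>x. ennreal \<bar>g i x\<bar>) R)"
      by (intro ennreal_prod_mono)
    also have "\<dots> = ennreal (6 ^ (CARD('n) * m)) * (\<Prod>i=1..m. mean lebesgue (\<lambda>x. ennreal \<bar>g i x\<bar>) R)"
      by (simp add: prod.distrib power_mult flip: ennreal_power)
    finally have "epowr (\<Prod>i=1..m. avg Q (g i)) p \<le> epowr (ennreal (6 ^ (CARD('n) * m)) * (\<Prod>i=1..m. mean lebesgue (\<lambda>x. ennreal \<bar>g i x\<bar>) R)) p"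
      using p by (intro epowr_mono) auto
    also have "\<dots> = ?K * epowr (\<Prod>i=1..m. mean lebesgue (\<lambda>x. ennreal \<bar>g i x\<bar>) R) p"
      by (simp only: epowr_mult) (simp add: epowr_ennreal)
    also have "\<dots> \<le> ?K * ?S \<alpha>"
      using R(1,2) Q(2) by (intro mult_left_mono SUP_upper2[of R]) auto
    also have "\<dots> \<le> B"
      unfolding B_def by (intro mult_left_mono member_le_sum[where f = ?S]) auto
    finally have "epowr (epowr (\<Prod>i=1..m. avg Q (g i)) p) (1 / p) \<le> epowr B (1 / p)"
      using p by (intro epowr_mono) auto
    then show "(\<Prod>i=1..m. avg Q (g i)) \<le> epowr B (1 / p)"
      using p by (simp add: epowr_epowr)
  qed
  then have "epowr (multi_maximal m g x) p \<le> epowr (epowr B (1 / p)) p"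
    using p by (intro epowr_mono) auto
  then show ?thesis using p by (simp add: epowr_epowr B_def)
qed

section \<open>The two-weight bound for the multisublinear maximal function\<close>

theorem theorem3p6:
  fixes m :: nat and P :: "nat \<Rightarrow> real" and p :: real
  assumes "1 \<le> m"
    and "\<And>i. i \<in> {1..m} \<Longrightarrow> 1 < P i"
    and "1 / p = (\<Sum>i=1..m. 1 / P i)"
  shows "\<exists>c::real. 0 < c \<and>
    (\<forall>(v :: real ^ 'n \<Rightarrow> real) (w :: nat \<Rightarrow> real ^ 'n \<Rightarrow> real) (\<sigma> :: nat \<Rightarrow> real ^ 'n \<Rightarrow> real)
        (f :: nat \<Rightarrow> real ^ 'n \<Rightarrow> real).
       weight v \<longrightarrow> (\<forall>i\<in>{1..m}. weight (w i)) \<longrightarrow>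
       (\<forall>i\<in>{1..m}. \<sigma> i = dual_weight (P i) (w i)) \<longrightarrow> (\<forall>i\<in>{1..m}. weight (\<sigma> i)) \<longrightarrow>
       (\<forall>i\<in>{1..m}. in_Lp (P i) (\<sigma> i) (f i)) \<longrightarrow>
       Lp_norm p v (multi_maximal m (\<lambda>i x. f i x * \<sigma> i x)) \<le>
         ennreal c * epowr (A_const m P p v w * W_const m P p \<sigma>) (1 / p) *
         (\<Prod>i=1..m. Lp_norm (P i) (\<sigma> i) (\<lambda>x. ennreal \<bar>f i x\<bar>)))"
proof -
  have "0 < (\<Sum>i=1..m. 1 / P i)"
    using assms(1,2) by (intro sum_pos) (auto intro!: divide_pos_pos less_trans[OF zero_less_one])
  then have p: "0 < p" using assms(3) by (metis zero_less_divide_1_iff)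
  have "(\<Sum>i=1..m. p / P i) = p * (\<Sum>i=1..m. 1 / P i)" by (simp add: sum_distrib_left)
  then have p1: "(\<Sum>i=1..m. p / P i) = 1" using p by (simp only: assms(3)[symmetric]) simp
  define K where "K = (6 ^ (CARD('n) * m)) powr p * (2 ^ CARD('n) * two_weight_const {1..m} P p)"
  have "0 < two_weight_const {1..m} P p"
    using assms(1) by (auto simp: two_weight_const_def maximal_const_def intro!: mult_pos_pos prod_pos)
  then have K: "0 < K" by (simp add: K_def)
  show ?thesis
  proof (intro exI[of _ "K powr (1 / p)"] conjI allI impI)
    show "0 < K powr (1 / p)" using K by simp
    fix v :: "real ^ 'n \<Rightarrow> real" and w \<sigma> f :: "nat \<Rightarrow> real ^ 'n \<Rightarrow> real"
    assume v: "weight v" and \<sigma>: "\<forall>i\<in>{1..m}. \<sigma> i = dual_weight (P i) (w i)" "\<forall>i\<in>{1..m}. weight (\<sigma> i)"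
      and f: "\<forall>i\<in>{1..m}. in_Lp (P i) (\<sigma> i) (f i)"
    define AW where "AW = A_const m P p v w * W_const m P p \<sigma>"
    define J where "J i = (\<integral>\<^sup>+x. epowr (ennreal \<bar>f i x\<bar>) (P i) * ennreal (\<sigma> i x) \<partial>lebesgue)" for i
    define S where "S \<alpha> x = (SUP Q\<in>grid \<alpha>. epowr (\<Prod>i=1..m. mean lebesgue (\<lambda>x. ennreal \<bar>f i x * \<sigma> i x\<bar>) Q) p * indicator Q x)"
      for \<alpha> :: "'n set" and x
    have grid_sets: "Q \<in> sets lebesgue" if "Q \<in> grid \<alpha>" for Q and \<alpha> :: "'n set"
      using grid_cell_closed_cube[OF that] conull_subset(1) cubes_measure(1) by metis
    have [measurable]: "S \<alpha> \<in> borel_measurable lebesgue" for \<alpha>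
      unfolding S_def using grid_sets by (intro borel_measurable_SUP countable_grid) auto
    have [measurable]: "v \<in> borel_measurable lebesgue"
      using v locally_integrable_measurable by (auto simp: weight_def)
    have grids: "(\<integral>\<^sup>+x. S \<alpha> x * ennreal \<bar>v x\<bar> \<partial>lebesgue)
        \<le> ennreal (two_weight_const {1..m} P p) * AW * (\<Prod>i=1..m. epowr (J i) (p / P i))" for \<alpha>
      unfolding S_def AW_def J_def
      using assms(1,2) p p1 v \<sigma> f by (intro grid_two_weight) (auto simp: in_Lp_def)
    have "(\<integral>\<^sup>+x. epowr (multi_maximal m (\<lambda>i x. f i x * \<sigma> i x) x) p * ennreal (v x) \<partial>lebesgue)
        \<le> (\<integral>\<^sup>+x. ennreal ((6 ^ (CARD('n) * m)) powr p) * (\<Sum>\<alpha>\<in>UNIV. S \<alpha> x * ennreal \<bar>v x\<bar>) \<partial>lebesgue)"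
    proof (rule nn_integral_mono)
      fix x
      have "epowr (multi_maximal m (\<lambda>i x. f i x * \<sigma> i x) x) p * ennreal (v x)
          \<le> (ennreal ((6 ^ (CARD('n) * m)) powr p) * (\<Sum>\<alpha>\<in>UNIV. S \<alpha> x)) * ennreal \<bar>v x\<bar>"
        unfolding S_def by (intro mult_mono multi_maximal_le_grids p ennreal_leI) auto
      then show "epowr (multi_maximal m (\<lambda>i x. f i x * \<sigma> i x) x) p * ennreal (v x)
          \<le> ennreal ((6 ^ (CARD('n) * m)) powr p) * (\<Sum>\<alpha>\<in>UNIV. S \<alpha> x * ennreal \<bar>v x\<bar>)"
        by (simp add: sum_distrib_right mult.assoc)
    qed
    also have "\<dots> = ennreal ((6 ^ (CARD('n) * m)) powr p) * (\<Sum>\<alpha>\<in>UNIV. \<integral>\<^sup>+x. S \<alpha> x * ennreal \<bar>v x\<bar> \<partial>lebesgue)"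
      by (simp add: nn_integral_cmult nn_integral_sum)
    also have "\<dots> \<le> ennreal ((6 ^ (CARD('n) * m)) powr p) *
        (\<Sum>\<alpha>\<in>(UNIV :: 'n set set). ennreal (two_weight_const {1..m} P p) * AW * (\<Prod>i=1..m. epowr (J i) (p / P i)))"
      by (intro mult_left_mono sum_mono grids) auto
    also have "\<dots> = ennreal K * AW * (\<Prod>i=1..m. epowr (J i) (p / P i))"
      using \<open>0 < two_weight_const {1..m} P p\<close>
      by (simp add: K_def ennreal_mult card_UNIV_set mult.assoc flip: ennreal_power)
    finally have "Lp_norm p v (multi_maximal m (\<lambda>i x. f i x * \<sigma> i x))
        \<le> epowr (ennreal K * AW * (\<Prod>i=1..m. epowr (J i) (p / P i))) (1 / p)"
      unfolding Lp_norm_def using p by (intro epowr_mono) auto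
    also have "\<dots> = ennreal (K powr (1 / p)) * epowr AW (1 / p) * (\<Prod>i=1..m. Lp_norm (P i) (\<sigma> i) (\<lambda>x. ennreal \<bar>f i x\<bar>))"
      using K p by (simp add: epowr_mult epowr_prod epowr_epowr epowr_ennreal Lp_norm_def J_def)
    finally show "Lp_norm p v (multi_maximal m (\<lambda>i x. f i x * \<sigma> i x)) \<le>
         ennreal (K powr (1 / p)) * epowr (A_const m P p v w * W_const m P p \<sigma>) (1 / p) *
         (\<Prod>i=1..m. Lp_norm (P i) (\<sigma> i) (\<lambda>x. ennreal \<bar>f i x\<bar>))"
      by (simp add: AW_def)
  qed
qed

end
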